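(* Let $N$ be a positive integer, $n\geq 2$ a positive integer, $k$ a nonnegative integer and $\Omega\subset\mathbb{R}^{N}$ a domain. Assume that the additive operators $T, A\colon \mathscr{C}^{k}(\Omega,\mathbb{R})\to\mathscr{C}(\Omega,\mathbb{R})$ satisfy \[ T(f^{n})= nf^{n-1}T(f)+nA(f)A(f^{n-1})\qquad \left(f\in\mathscr{C}^{k}(\Omega,\mathbb{R})\right) \] and that $A$ is non-degenerate, depends non-trivially on the derivative and annihilates the identically $1$ function. If $n=2$ or $A(1)=0$, then there are continuous functions $b,c\in\mathscr{C}(\Omega,\mathbb{R}^{N})$ such that \[ \begin{array}{rcl} T(f)(x)&=&\langle f''(x)c(x),c(x)\rangle+\langle f'(x),b(x)\rangle\\[1mm] A(f)(x)&=&\langle f'(x),c(x)\rangle \end{array} \qquad\left(f\in\mathscr{C}^{k}(\Omega,\mathbb{R}),\ x\in\Omega\right). \] Further, if $k=1$, then necessarily $c\equiv 0$; and if $k=0$, then necessarily $b\equiv 0$ and $c\equiv 0$. Conversely, the operators of the form $T(f)(x)=\langle f''(x)c(x),c(x)\rangle+\langle f'(x),b(x)\rangle$, $A(f)(x)=\langle f'(x),c(x)\rangle$ $\left(f\in\mathscr{C}^{k}(\Omega,\mathbb{R}),\ x\in\Omega\right)$ with $b,c\in\mathscr{C}(\Omega,\mathbb{R}^{N})$ (with $c\equiv 0$ if $k=1$, and $b\equiv 0$, $c\equiv 0$ if $k=0$) are additive and satisfy $T(f^{n})= nf^{n-1}T(f)+nA(f)A(f^{n-1})$ for all $f\in\m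athscr{C}^{k}(\Omega,\mathbb{R})$.
   Context: A domain is a nonempty, open and connected set. $\mathscr{C}^{k}(\Omega,\mathbb{R})$ is the ring (pointwise operations) of real-valued $k$-times continuously differentiable functions on $\Omega$; $\mathscr{C}(\Omega,\mathbb{R}^{m})$ is the space of continuous $\mathbb{R}^m$-valued functions on $\Omega$. An operator $T$ is additive if $T(f+g)=T(f)+T(g)$ for all $f,g$ (no linearity or continuity assumed). $f'(x)=\nabla f(x)\in\mathbb{R}^N$ is the gradient, $f''(x)$ the Hessian matrix, $\langle\cdot,\cdot\rangle$ the standard inner product of $\mathbb{R}^N$. In the formulas $T(f)(x)=\langle f''(x)c(x),c(x)\rangle+\langle f'(x),b(x)\rangle$ and $A(f)(x)=\langle f'(x),c(x)\rangle$, if $k=1$ (so that $c\equiv 0$) the term containing $f''$ is read as $0$, and if $k=0$ (so that $b\equiv c\equiv 0$) all terms containing $f'$ or $f''$ are read as $0$. Non-degenerate: an operator $A\colon\mathscr{C}^{k}(\Omega,\mathbb{R})\to\mathscr{C}(\Omega,\mathbb{R})$ is non-degenerate if for each nonempty open subset $U\subset\Omega$ and all $x\in U$ there exist functions $g_1,g_2\in\mathscr{C}^{k}(\Omega,\mathbb{R})$ with supports in $U$ such that the vectors $(g_i(x),(Ag_i)(x))\in\mathbb{R}^{2}$, $i=1,2$, are linearly independent in $\mathbb{R}^2$. Depends non-trivially on the derivative: $A\colon\mathscr{C}^{k}(\Omega,\mathbb{R})\to\mathscr{C}(\Omega,\mathbb{R})$ depends non-trivially on the derivative if there exist $x\in\Omega$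 and $f_1,f_2\in\mathscr{C}^{k}(\Omega,\mathbb{R})$ such that $f_1(x)=f_2(x)$ and $(Af_1)(x)\neq(Af_2)(x)$. *)

theory Defs
  imports "HOL-Analysis.Analysis"
begin

definition domain_set :: "(real ^ 'N) set \<Rightarrow> bool" where
  "domain_set \<Omega> \<longleftrightarrow> \<Omega> \<noteq> {} \<and> open \<Omega> \<and> connected \<Omega>"

text \<open>
  Meant for open sets \<Omega>. A function on \<Omega> is represented by a total function whose values
  off \<Omega> are irrelevant.
\<close>

primrec cont_diff_on :: "nat \<Rightarrow> (real ^ 'N) set \<Rightarrow> (real ^ 'N \<Rightarrow> real) \<Rightarrow> bool" where
  "cont_diff_on 0 \<Omega> f \<longleftrightarrow> continuous_on \<Omega> f"
| "cont_diff_on (Suc k) \<Omega> f \<longleftrightarrow>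
     (\<forall>x\<in>\<Omega>. f differentiable (at x)) \<and>
     (\<forall>v. cont_diff_on k \<Omega> (\<lambda>x. frechet_derivative f (at x) v))"

definition Ck :: "nat \<Rightarrow> (real ^ 'N) set \<Rightarrow> (real ^ 'N \<Rightarrow> real) set" where
  "Ck k \<Omega> = {f. cont_diff_on k \<Omega> f}"

definition gradient :: "(real ^ 'N \<Rightarrow> real) \<Rightarrow> real ^ 'N \<Rightarrow> real ^ 'N" where
  "gradient f x = (\<chi> i. frechet_derivative f (at x) (axis i 1))"

lemma GDERIV_gradient:
  assumes "f differentiable (at x)"
  shows "GDERIV f x :> gradient f x"
proof -
  have D: "(f has_derivative frechet_derivative f (at x)) (at x)"
    using assms by (simp add: frechet_derivative_works)
  then have lin: "linear (frechet_derivative f (at x))"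
    by (rule has_derivative_linear)
  have "frechet_derivative f (at x) h = inner h (gradient f x)" for h
  proof -
    have "frechet_derivative f (at x) h
        = frechet_derivative f (at x) (\<Sum>i\<in>UNIV. h $ i *\<^sub>R axis i 1)"
      by (simp add: basis_expansion flip: scalar_mult_eq_scaleR)
    also have "\<dots> = (\<Sum>i\<in>UNIV. h $ i * frechet_derivative f (at x) (axis i 1))"
      by (simp add: linear_sum[OF lin] linear_cmul[OF lin])
    also have "\<dots> = inner h (gradient f x)"
      by (simp add: gradient_def inner_vec_def)
    finally show ?thesis .
  qed
  then have "frechet_derivative f (at x) = (\<lambda>h. inner h (gradient f x))"
    by blast
  with D show ?thesis by (simp add: gderiv_def)
qed

definition hessian :: "(real ^ 'N \<Rightarrow> real) \<Rightarrow> real ^ 'N \<Rightarrow> real ^ 'N ^ 'N" where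
  "hessian f x = jacobian (gradient f) (at x)"

text \<open>
  A map from \<open>Ck k \<Omega>\<close> to the continuous functions on \<Omega>. The second conjunct makes it well
  defined: the result on \<Omega> depends only on the restriction of the argument to \<Omega>.
\<close>

definition Ck_operator ::
    "nat \<Rightarrow> (real ^ 'N) set \<Rightarrow> ((real ^ 'N \<Rightarrow> real) \<Rightarrow> real ^ 'N \<Rightarrow> real) \<Rightarrow> bool" where
  "Ck_operator k \<Omega> T \<longleftrightarrow>
     (\<forall>f\<in>Ck k \<Omega>. continuous_on \<Omega> (T f)) \<and>
     (\<forall>f\<in>Ck k \<Omega>. \<forall>g\<in>Ck k \<Omega>. (\<forall>x\<in>\<Omega>. f x = g x) \<longrightarrow> (\<forall>x\<in>\<Omega>. T f x = T g x))"

definition additive_operator ::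
    "nat \<Rightarrow> (real ^ 'N) set \<Rightarrow> ((real ^ 'N \<Rightarrow> real) \<Rightarrow> real ^ 'N \<Rightarrow> real) \<Rightarrow> bool" where
  "additive_operator k \<Omega> T \<longleftrightarrow>
     (\<forall>f\<in>Ck k \<Omega>. \<forall>g\<in>Ck k \<Omega>. \<forall>x\<in>\<Omega>. T (\<lambda>y. f y + g y) x = T f x + T g x)"

text \<open>The support is the closure relative to \<Omega>.\<close>

definition support_in :: "(real ^ 'N) set \<Rightarrow> (real ^ 'N \<Rightarrow> real) \<Rightarrow> (real ^ 'N) set" where
  "support_in \<Omega> g = \<Omega> \<inter> closure (support_on \<Omega> g)"

text \<open>
  \<open>independent\<close> speaks about a set, so the two vectors must also be required to be distinct.
\<close>

definition non_degenerate ::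
    "nat \<Rightarrow> (real ^ 'N) set \<Rightarrow> ((real ^ 'N \<Rightarrow> real) \<Rightarrow> real ^ 'N \<Rightarrow> real) \<Rightarrow> bool" where
  "non_degenerate k \<Omega> A \<longleftrightarrow>
     (\<forall>U. U \<noteq> {} \<and> open U \<and> U \<subseteq> \<Omega> \<longrightarrow>
       (\<forall>x\<in>U. \<exists>g\<^sub>1\<in>Ck k \<Omega>. \<exists>g\<^sub>2\<in>Ck k \<Omega>.
          support_in \<Omega> g\<^sub>1 \<subseteq> U \<and> support_in \<Omega> g\<^sub>2 \<subseteq> U \<and>
          (g\<^sub>1 x, A g\<^sub>1 x) \<noteq> (g\<^sub>2 x, A g\<^sub>2 x) \<and>
          independent {(g\<^sub>1 x, A g\<^sub>1 x), (g\<^sub>2 x, A g\<^sub>2 x)}))"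

definition depends_nontrivially_on_derivative ::
    "nat \<Rightarrow> (real ^ 'N) set \<Rightarrow> ((real ^ 'N \<Rightarrow> real) \<Rightarrow> real ^ 'N \<Rightarrow> real) \<Rightarrow> bool" where
  "depends_nontrivially_on_derivative k \<Omega> A \<longleftrightarrow>
     (\<exists>x\<in>\<Omega>. \<exists>f\<^sub>1\<in>Ck k \<Omega>. \<exists>f\<^sub>2\<in>Ck k \<Omega>. f\<^sub>1 x = f\<^sub>2 x \<and> A f\<^sub>1 x \<noteq> A f\<^sub>2 x)"

definition power_identity ::
    "nat \<Rightarrow> nat \<Rightarrow> (real ^ 'N) set \<Rightarrow> ((real ^ 'N \<Rightarrow> real) \<Rightarrow> real ^ 'N \<Rightarrow> real) \<Rightarrow>
     ((real ^ 'N \<Rightarrow> real) \<Rightarrow> real ^ 'N \<Rightarrow> real) \<Rightarrow> bool" where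
  "power_identity n k \<Omega> T A \<longleftrightarrow>
     (\<forall>f\<in>Ck k \<Omega>. \<forall>x\<in>\<Omega>.
        T (\<lambda>y. f y ^ n) x
          = real n * f x ^ (n - 1) * T f x + real n * A f x * A (\<lambda>y. f y ^ (n - 1)) x)"

text \<open>
  The derivative of order \<open>j\<close> contributes only when \<open>j \<le> k\<close>: terms containing a derivative that
  need not exist on \<open>Ck k \<Omega>\<close> are read as 0.
\<close>

definition first_order_part ::
    "nat \<Rightarrow> (real ^ 'N \<Rightarrow> real ^ 'N) \<Rightarrow> (real ^ 'N \<Rightarrow> real) \<Rightarrow> real ^ 'N \<Rightarrow> real" where
  "first_order_part k b f x = (if 1 \<le> k then gradient f x \<bullet> b x else 0)"

definition second_order_part ::
    "nat \<Rightarrow> (real ^ 'N \<Rightarrow> real ^ 'N) \<Rightarrow> (real ^ 'N \<Rightarrow> real) \<Rightarrow> real ^ 'N \<Rightarrow> real" where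
  "second_order_part k c f x = (if 2 \<le> k then (hessian f x *v c x) \<bullet> c x else 0)"

definition has_differential_form ::
    "nat \<Rightarrow> (real ^ 'N) set \<Rightarrow> (real ^ 'N \<Rightarrow> real ^ 'N) \<Rightarrow> (real ^ 'N \<Rightarrow> real ^ 'N) \<Rightarrow>
     ((real ^ 'N \<Rightarrow> real) \<Rightarrow> real ^ 'N \<Rightarrow> real) \<Rightarrow>
     ((real ^ 'N \<Rightarrow> real) \<Rightarrow> real ^ 'N \<Rightarrow> real) \<Rightarrow> bool" where
  "has_differential_form k \<Omega> b c T A \<longleftrightarrow>
     (\<forall>f\<in>Ck k \<Omega>. \<forall>x\<in>\<Omega>.
        T f x = second_order_part k c f x + first_order_part k b f x \<and>
        A f x = first_order_part k c f x)"

end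

theory Submission
  imports Defs "HOL-Complex_Analysis.Complex_Analysis"
begin

text \<open>
  Applying the identity to \<open>1 + r f\<close> and comparing coefficients of \<open>r\<^sup>2\<close> gives the second-order
  Leibniz rule \<open>T (f g) = f T g + g T f + 2 A f A g\<close>, and associativity of the product together with
  non-degeneracy then makes \<open>A\<close> a derivation. Hence both operators are local, and continuity of the
  images shows, by a gliding hump argument, that they annihilate constants, and, by cutting along
  half spaces, that their value at a point depends only on the \<open>k\<close>-jet there. It remains to
  evaluate them on Taylor polynomials, where the Leibniz rules decide everything.
\<close>

subsection \<open>Directional derivatives\<close>

text \<open>Real scalars are the main obstacle. Additivity gives homogeneity over the rationals
  only, and the field of reals has nonzero (discontinuous) derivations, so \<open>T\<close> and
  \<open>A\<close> could a priori act on the values of a function instead of its derivatives. Hence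
  the identity is tested on 1 + m f with natural m only, and real scalars can be pulled out only
  once constants are known to be annihilated. The one regularity available is that
  \<open>T f\<close> and \<open>A f\<close> are continuous in the point; no continuity in f is
  given. The second obstacle is that a function with vanishing k-jet at a need not vanish on any
  open set with a in its closure, so locality says nothing about it directly. Multiplying it by a
  function homogeneous of degree 0 about a keeps it of class C^k although the multiplier may be
  discontinuous at a: k-flatness pays exactly for the loss. This splits it into finitely many
  pieces, each zero on an open half space bounded through a. The same fact explains small k: the
  square of y_i - x_i is flat of order 1, so for k \<le> 1 it is killed by \<open>T\<close> at x,
  whereas the second-order rule gives it the value 2 A(y_i)^2.\<close>

definition dird :: "real ^ 'N \<Rightarrow> (real ^ 'N \<Rightarrow> real) \<Rightarrow> real ^ 'N \<Rightarrow> real" where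
  "dird v f x = frechet_derivative f (at x) v"

lemma dird_eq: "(f has_derivative f') (at x) \<Longrightarrow> dird v f x = f' v"
  unfolding dird_def by (metis frechet_derivative_at)

lemma has_derivative_dird:
  "f differentiable (at x) \<Longrightarrow> (f has_derivative (\<lambda>v. dird v f x)) (at x)"
  unfolding dird_def by (simp add: frechet_derivative_works)

text \<open>The recursion in terms of \<open>dird\<close> replaces the defining equation, so that
  iterated derivatives stay in the form \<open>dird v (dird w f)\<close>.\<close>

lemma cont_diff_on_Suc:
  "cont_diff_on (Suc k) \<Omega> f \<longleftrightarrow>
     (\<forall>x\<in>\<Omega>. f differentiable (at x)) \<and> (\<forall>v. cont_diff_on k \<Omega> (dird v f))"
  by (simp add: dird_def[abs_def])

declare cont_diff_on.simps(2) [simp del]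

text \<open>No differentiability is assumed: \<open>frechet_derivative\<close> is a choice from the
  set of derivatives, and this set is the same for both functions.\<close>

lemma dird_cong:
  assumes "open \<Omega>" "x \<in> \<Omega>" "\<And>y. y \<in> \<Omega> \<Longrightarrow> f y = g y"
  shows "dird v f x = dird v g x"
proof -
  have "(f has_derivative D) (at x) \<longleftrightarrow> (g has_derivative D) (at x)" for D
    using has_derivative_transform_within_open[OF _ assms(1,2), of f D UNIV g]
      has_derivative_transform_within_open[OF _ assms(1,2), of g D UNIV f] assms(3) by auto
  then show ?thesis by (simp add: dird_def frechet_derivative_def)
qed

lemma dird_const [simp]: "dird v (\<lambda>x. c) x = 0"
  by (rule dird_eq) simp

lemma dird_linear: "bounded_linear f \<Longrightarrow> dird v f x = f v"
  by (rule dird_eq) (rule bounded_linear_imp_has_derivative)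

lemma dird_nth [simp]: "dird v (\<lambda>x. x $ i) x = v $ i"
  by (intro dird_linear bounded_linear_vec_nth)

lemma dird_add:
  "f differentiable (at x) \<Longrightarrow> g differentiable (at x) \<Longrightarrow>
   dird v (\<lambda>x. f x + g x) x = dird v f x + dird v g x"
  by (rule dird_eq) (intro has_derivative_add has_derivative_dird)

lemma dird_diff:
  "f differentiable (at x) \<Longrightarrow> g differentiable (at x) \<Longrightarrow>
   dird v (\<lambda>x. f x - g x) x = dird v f x - dird v g x"
  by (rule dird_eq) (intro has_derivative_diff has_derivative_dird)

lemma dird_mult:
  "f differentiable (at x) \<Longrightarrow> g differentiable (at x) \<Longrightarrow>
   dird v (\<lambda>x. f x * g x) x = f x * dird v g x + dird v f x * g x"
  by (rule dird_eq) (intro has_derivative_mult has_derivative_dird)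

lemma dird_cmult:
  "f differentiable (at x) \<Longrightarrow> dird v (\<lambda>x. c * f x) x = c * dird v f x"
  by (subst dird_mult) auto

lemma dird_sum:
  "finite I \<Longrightarrow> (\<And>i. i \<in> I \<Longrightarrow> f i differentiable (at x)) \<Longrightarrow>
   dird v (\<lambda>x. \<Sum>i\<in>I. f i x) x = (\<Sum>i\<in>I. dird v (f i) x)"
  by (rule dird_eq) (intro has_derivative_sum has_derivative_dird)

lemma dird_DERIV:
  assumes "f differentiable (at x)" "(h has_real_derivative d) (at (f x))"
  shows "dird v (\<lambda>x. h (f x)) x = d * dird v f x"
    and "(\<lambda>x. h (f x)) differentiable (at x)"
proof -
  have "((\<lambda>x. h (f x)) has_derivative (\<lambda>v. d * dird v f x)) (at x)"
    using has_derivative_compose[OF has_derivative_dird[OF assms(1)]]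
      assms(2)[unfolded has_field_derivative_def] by blast
  then show "dird v (\<lambda>x. h (f x)) x = d * dird v f x"
    and "(\<lambda>x. h (f x)) differentiable (at x)"
    by (auto simp: differentiable_def dest: dird_eq)
qed

lemma dird_expand:
  assumes "f differentiable (at x)"
  shows "dird v f x = (\<Sum>i\<in>UNIV. v $ i * dird (axis i 1) f x)"
proof -
  have lin: "linear (\<lambda>v. dird v f x)"
    using has_derivative_dird[OF assms] by (rule has_derivative_linear)
  have "dird v f x = dird (\<Sum>i\<in>UNIV. v $ i *\<^sub>R axis i 1) f x"
    by (simp add: basis_expansion flip: scalar_mult_eq_scaleR)
  also have "\<dots> = (\<Sum>i\<in>UNIV. v $ i * dird (axis i 1) f x)"
    by (simp add: linear_sum[OF lin] linear_cmul[OF lin])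
  finally show ?thesis .
qed

lemma dird_zero [simp]: "f differentiable (at x) \<Longrightarrow> dird 0 f x = 0"
  by (subst dird_expand) auto

text \<open>Away from 0 the function is locally 0 or a monomial; at 0 the difference quotient is
  \<open>max 0 h ^ (q - 1)\<close>, which tends to 0 because q - 1 is positive. Such powers serve as
  cut-offs of class C^k.\<close>

lemma DERIV_pos_part_power:
  assumes "2 \<le> q"
  shows "((\<lambda>t. max 0 t ^ q) has_real_derivative real q * max 0 t ^ (q - 1)) (at (t::real))"
proof -
  have "q = Suc (Suc (q - 2))" using assms by simp
  then obtain m where m: "q = Suc (Suc m)" by blast
  show ?thesis
  proof (cases t "0::real" rule: linorder_cases)
    case less
    have "((\<lambda>t. 0) has_real_derivative 0) (at t)" by simp
    then have "((\<lambda>t. max 0 t ^ q) has_real_derivative 0) (at t)"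
      by (rule has_field_derivative_transform_within_open[where S = "{..<0}"]) (use less m in auto)
    with less m show ?thesis by simp
  next
    case greater
    have "((\<lambda>t. t ^ q) has_real_derivative real q * t ^ (q - 1)) (at t)"
      by (auto intro!: derivative_eq_intros)
    then have "((\<lambda>t. max 0 t ^ q) has_real_derivative real q * t ^ (q - 1)) (at t)"
      by (rule has_field_derivative_transform_within_open[where S = "{0<..}"]) (use greater in auto)
    with greater show ?thesis by simp
  next
    case equal
    have "((\<lambda>h::real. max 0 h ^ Suc m) \<longlongrightarrow> max 0 0 ^ Suc m) (at 0)"
      by (intro tendsto_intros)
    then have "((\<lambda>h::real. max 0 h ^ Suc m) \<longlongrightarrow> 0) (at 0)"
      by simp
    moreover have "\<forall>\<^sub>F h::real in at 0. max 0 h ^ Suc m = max 0 h ^ Suc (Suc m) / h"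
      by (auto simp: eventually_at max_def intro!: exI[of _ 1])
    ultimately have "((\<lambda>h::real. max 0 h ^ Suc (Suc m) / h) \<longlongrightarrow> 0) (at 0)"
      by (rule Lim_transform_eventually)
    then show ?thesis using equal m by (simp add: DERIV_def)
  qed
qed

subsection \<open>The ring of k times continuously differentiable functions\<close>

context
  fixes \<Omega> :: "(real ^ 'N) set"
  assumes op: "open \<Omega>"
begin

lemma cont_diff_on_cong:
  assumes "cont_diff_on k \<Omega> f" "\<And>x. x \<in> \<Omega> \<Longrightarrow> f x = g x"
  shows "cont_diff_on k \<Omega> g"
  using assms
proof (induction k arbitrary: f g)
  case 0
  then show ?case by (auto cong: continuous_on_cong)
next
  case (Suc k)
  have "g differentiable (at x)" if "x \<in> \<Omega>" for x
    using Suc.prems(1) that has_derivative_transform_within_open[OF _ op that, of f _ UNIV g]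
      Suc.prems(2)
    unfolding cont_diff_on_Suc differentiable_def by blast
  moreover have "cont_diff_on k \<Omega> (dird v g)" for v
    using Suc.IH[of "dird v f" "dird v g"] Suc.prems dird_cong[OF op]
    unfolding cont_diff_on_Suc by metis
  ultimately show ?case unfolding cont_diff_on_Suc by blast
qed

lemma cont_diff_on_SucD: "cont_diff_on (Suc k) \<Omega> f \<Longrightarrow> cont_diff_on k \<Omega> f"
proof (induction k arbitrary: f)
  case 0
  then show ?case
    by (auto simp: cont_diff_on_Suc continuous_on_eq_continuous_at[OF op]
        differentiable_imp_continuous_within)
next
  case (Suc k)
  then show ?case by (meson cont_diff_on_Suc)
qed

lemma cont_diff_on_mono: "cont_diff_on k \<Omega> f \<Longrightarrow> j \<le> k \<Longrightarrow> cont_diff_on j \<Omega> f"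
  by (rule inc_induct[of j k "\<lambda>j. cont_diff_on j \<Omega> f"]) (auto dest: cont_diff_on_SucD)

lemma cont_diff_on_continuous: "cont_diff_on k \<Omega> f \<Longrightarrow> continuous_on \<Omega> f"
  using cont_diff_on_mono[of k f 0] by simp

lemma cont_diff_on_differentiable:
  "cont_diff_on k \<Omega> f \<Longrightarrow> 1 \<le> k \<Longrightarrow> x \<in> \<Omega> \<Longrightarrow> f differentiable (at x)"
  by (cases k) (auto simp: cont_diff_on_Suc)

lemma cont_diff_on_const [intro]: "cont_diff_on k \<Omega> (\<lambda>x. c)"
proof (induction k arbitrary: c)
  case (Suc k)
  then show ?case
    unfolding cont_diff_on_Suc using cont_diff_on_cong[OF Suc, of 0] by auto
qed simp

lemma cont_diff_on_linear: "bounded_linear f \<Longrightarrow> cont_diff_on k \<Omega> f"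
proof (cases k)
  case (Suc j)
  assume f: "bounded_linear f"
  have "cont_diff_on j \<Omega> (dird v f)" for v
    by (rule cont_diff_on_cong[OF cont_diff_on_const[of j "f v"]]) (simp add: dird_linear f)
  then show ?thesis
    unfolding cont_diff_on_Suc Suc using f bounded_linear_imp_differentiable by blast
qed (simp add: linear_continuous_on)

lemma cont_diff_on_nth [intro]: "cont_diff_on k \<Omega> (\<lambda>x. x $ i)"
  by (intro cont_diff_on_linear bounded_linear_vec_nth)

lemma cont_diff_on_add [intro]:
  "cont_diff_on k \<Omega> f \<Longrightarrow> cont_diff_on k \<Omega> g \<Longrightarrow> cont_diff_on k \<Omega> (\<lambda>x. f x + g x)"
proof (induction k arbitrary: f g)
  case 0
  then show ?case by (auto intro: continuous_on_add)
next
  case (Suc k)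
  have "cont_diff_on k \<Omega> (dird v (\<lambda>x. f x + g x))" for v
    by (rule cont_diff_on_cong[OF Suc.IH[of "dird v f" "dird v g"]])
       (use Suc.prems in \<open>auto simp: cont_diff_on_Suc dird_add\<close>)
  with Suc.prems show ?case
    by (auto simp: cont_diff_on_Suc)
qed

lemma cont_diff_on_mult [intro]:
  "cont_diff_on k \<Omega> f \<Longrightarrow> cont_diff_on k \<Omega> g \<Longrightarrow> cont_diff_on k \<Omega> (\<lambda>x. f x * g x)"
proof (induction k arbitrary: f g)
  case 0
  then show ?case by (auto intro: continuous_on_mult)
next
  case (Suc k)
  note le = Suc.prems[THEN cont_diff_on_SucD]
  have "cont_diff_on k \<Omega> (dird v (\<lambda>x. f x * g x))" for v
    by (rule cont_diff_on_cong[OF cont_diff_on_add[OF Suc.IH[of f "dird v g"] Suc.IH[of "dird v f" g]]])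
       (use Suc.prems le in \<open>auto simp: cont_diff_on_Suc dird_mult\<close>)
  with Suc.prems show ?case
    by (auto simp: cont_diff_on_Suc)
qed

lemma cont_diff_on_diff [intro]:
  "cont_diff_on k \<Omega> f \<Longrightarrow> cont_diff_on k \<Omega> g \<Longrightarrow> cont_diff_on k \<Omega> (\<lambda>x. f x - g x)"
  using cont_diff_on_add[OF _ cont_diff_on_mult[OF cont_diff_on_const[of k "-1"]], of f g] by simp

lemma cont_diff_on_power [intro]: "cont_diff_on k \<Omega> f \<Longrightarrow> cont_diff_on k \<Omega> (\<lambda>x. f x ^ n)"
  by (induction n) auto

lemma cont_diff_on_sum [intro]:
  "(\<And>i. i \<in> I \<Longrightarrow> cont_diff_on k \<Omega> (f i)) \<Longrightarrow> cont_diff_on k \<Omega> (\<lambda>x. \<Sum>i\<in>I. f i x)"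
  by (induction I rule: infinite_finite_induct) auto

lemma cont_diff_on_prod [intro]:
  "(\<And>i. i \<in> I \<Longrightarrow> cont_diff_on k \<Omega> (f i)) \<Longrightarrow> cont_diff_on k \<Omega> (\<lambda>x. \<Prod>i\<in>I. f i x)"
  by (induction I rule: infinite_finite_induct) auto

lemma cont_diff_on_polynomial:
  "real_polynomial_function p \<Longrightarrow> cont_diff_on k \<Omega> p"
  by (induction rule: real_polynomial_function.induct) (auto intro: cont_diff_on_linear)

text \<open>All real exponents are treated at once because each derivative lowers the exponent by 1.
  The exponent 1/2 later supplies square roots.\<close>

lemma cont_diff_on_powr:
  "cont_diff_on k \<Omega> f \<Longrightarrow> (\<And>x. x \<in> \<Omega> \<Longrightarrow> f x > 0) \<Longrightarrow> cont_diff_on k \<Omega> (\<lambda>x. f x powr a)"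
proof (induction k arbitrary: a)
  case 0
  then show ?case by (fastforce intro!: continuous_intros)
next
  case (Suc k)
  have d: "f differentiable (at x)" if "x \<in> \<Omega>" for x
    using Suc.prems that by (auto simp: cont_diff_on_Suc)
  have D: "((\<lambda>t. t powr a) has_real_derivative a * f x powr (a - 1)) (at (f x))" if "x \<in> \<Omega>" for x
    using Suc.prems(2)[OF that] by (rule has_real_derivative_powr)
  have "cont_diff_on k \<Omega> (dird v (\<lambda>x. f x powr a))" for v
  proof (rule cont_diff_on_cong)
    have "cont_diff_on k \<Omega> f" "cont_diff_on k \<Omega> (dird v f)"
      using Suc.prems(1) cont_diff_on_SucD by (auto simp: cont_diff_on_Suc)
    then show "cont_diff_on k \<Omega> (\<lambda>x. a * f x powr (a - 1) * dird v f x)"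
      by (intro cont_diff_on_mult cont_diff_on_const Suc.IH Suc.prems(2))
    show "a * f x powr (a - 1) * dird v f x = dird v (\<lambda>x. f x powr a) x" if "x \<in> \<Omega>" for x
      using dird_DERIV(1)[OF d D, OF that that] by simp
  qed
  then show ?case
    using dird_DERIV(2)[OF d D] by (auto simp: cont_diff_on_Suc)
qed

text \<open>Each derivative costs one power, and \<open>k < q\<close> leaves a positive exponent
  after k of them, so continuity survives at the zeros of f.\<close>

lemma cont_diff_on_pos_part_power:
  "cont_diff_on k \<Omega> f \<Longrightarrow> k < q \<Longrightarrow> cont_diff_on k \<Omega> (\<lambda>x. max 0 (f x) ^ q)"
proof (induction k arbitrary: q)
  case 0
  then show ?case by (auto intro!: continuous_intros)
next
  case (Suc k)
  have d: "f differentiable (at x)" if "x \<in> \<Omega>" for x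
    using Suc.prems that by (auto simp: cont_diff_on_Suc)
  have D: "((\<lambda>t. max 0 t ^ q) has_real_derivative real q * max 0 t ^ (q - 1)) (at t)" for t :: real
    using Suc.prems(2) by (intro DERIV_pos_part_power) simp
  have "cont_diff_on k \<Omega> (dird v (\<lambda>x. max 0 (f x) ^ q))" for v
  proof (rule cont_diff_on_cong)
    have "cont_diff_on k \<Omega> f" "cont_diff_on k \<Omega> (dird v f)"
      using Suc.prems(1) cont_diff_on_SucD by (auto simp: cont_diff_on_Suc)
    then show "cont_diff_on k \<Omega> (\<lambda>x. real q * max 0 (f x) ^ (q - 1) * dird v f x)"
      using Suc.IH[of "q - 1"] Suc.prems(2) by (intro cont_diff_on_mult cont_diff_on_const) auto
    show "real q * max 0 (f x) ^ (q - 1) * dird v f x = dird v (\<lambda>x. max 0 (f x) ^ q) x"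
      if "x \<in> \<Omega>" for x
      using dird_DERIV(1)[OF d D, OF that] by simp
  qed
  then show ?case
    using dird_DERIV(2)[OF d D] by (auto simp: cont_diff_on_Suc)
qed

end

lemma nth_differentiable [simp]: "(\<lambda>x. x $ i) differentiable F"
  by (simp add: bounded_linear_imp_differentiable bounded_linear_vec_nth)

subsection \<open>Symmetry of second derivatives and Taylor polynomials\<close>

lemma dird_scaleR:
  assumes "f differentiable (at x)"
  shows "dird (c *\<^sub>R v) f x = c * dird v f x"
  using linear_cmul[OF has_derivative_linear[OF has_derivative_dird[OF assms]]] by simp

lemma DERIV_along_line:
  assumes "f differentiable (at (p + s *\<^sub>R v))"
  shows "((\<lambda>s. f (p + s *\<^sub>R v)) has_real_derivative dird v f (p + s *\<^sub>R v)) (at s)"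
proof -
  have "((\<lambda>s. p + s *\<^sub>R v) has_derivative (\<lambda>h. h *\<^sub>R v)) (at s)"
    by (auto intro!: derivative_eq_intros)
  from has_derivative_compose[OF this has_derivative_dird[OF assms]]
  show ?thesis
    by (simp add: has_field_derivative_def dird_scaleR[OF assms] mult.commute[of _ "dird v f _"])
qed

text \<open>The mean value theorem is applied in direction v to the increment in direction w, and
  then in direction w. The second difference on the left is symmetric in v and w, the right side is
  not: this is the source of Schwarz's theorem.\<close>

lemma second_difference_mean_value:
  fixes f :: "real ^ 'N \<Rightarrow> real"
  assumes f: "cont_diff_on 2 \<Omega> f" and t: "0 < t" and sub: "cball x (t * (norm v + norm w)) \<subseteq> \<Omega>"
  shows "\<exists>y. dist x y \<le> t * (norm v + norm w) \<and>
    f (x + t *\<^sub>R v + t *\<^sub>R w) - f (x + t *\<^sub>R v) - f (x + t *\<^sub>R w) + f x = t\<^sup>2 * dird w (dird v f) y"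
proof -
  have in\<Omega>: "x + s *\<^sub>R v + r *\<^sub>R w \<in> cball x (t * (norm v + norm w))"
    if "0 \<le> s" "s \<le> t" "0 \<le> r" "r \<le> t" for s r
  proof -
    have "norm (s *\<^sub>R v + r *\<^sub>R w) \<le> s * norm v + r * norm w"
      using norm_triangle_ineq[of "s *\<^sub>R v" "r *\<^sub>R w"] that by simp
    also have "\<dots> \<le> t * norm v + t * norm w"
      using that by (intro add_mono mult_right_mono) auto
    finally show ?thesis
      by (simp add: dist_norm algebra_simps norm_minus_commute[of x] flip: diff_diff_eq)
         (metis add.commute minus_add_distrib norm_minus_cancel uminus_add_conv_diff)
  qed
  have d1: "f differentiable (at y)" and d2: "dird v f differentiable (at y)" if "y \<in> \<Omega>" for y
    using f that by (auto simp: numeral_2_eq_2 cont_diff_on_Suc)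
  have "((\<lambda>s. f (x + s *\<^sub>R v + t *\<^sub>R w) - f (x + s *\<^sub>R v)) has_real_derivative
      dird v f (x + s *\<^sub>R v + t *\<^sub>R w) - dird v f (x + s *\<^sub>R v)) (at s)" if "0 \<le> s" "s \<le> t" for s
  proof (rule DERIV_diff)
    show "((\<lambda>s. f (x + s *\<^sub>R v)) has_real_derivative dird v f (x + s *\<^sub>R v)) (at s)"
      using in\<Omega>[of s 0] that t sub by (intro DERIV_along_line d1) auto
    have "x + t *\<^sub>R w + s *\<^sub>R v \<in> \<Omega>"
      using in\<Omega>[of s t] that t sub by (auto simp: ac_simps)
    from DERIV_along_line[OF d1[OF this]]
    show "((\<lambda>s. f (x + s *\<^sub>R v + t *\<^sub>R w)) has_real_derivative dird v f (x + s *\<^sub>R v + t *\<^sub>R w)) (at s)"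
      by (simp add: ac_simps)
  qed
  from MVT2[OF t this] obtain \<xi> where \<xi>: "0 < \<xi>" "\<xi> < t"
    and 1: "f (x + t *\<^sub>R v + t *\<^sub>R w) - f (x + t *\<^sub>R v) - (f (x + t *\<^sub>R w) - f x)
      = t * (dird v f (x + \<xi> *\<^sub>R v + t *\<^sub>R w) - dird v f (x + \<xi> *\<^sub>R v))"
    by auto
  have "((\<lambda>r. dird v f (x + \<xi> *\<^sub>R v + r *\<^sub>R w)) has_real_derivative
      dird w (dird v f) (x + \<xi> *\<^sub>R v + r *\<^sub>R w)) (at r)" if "0 \<le> r" "r \<le> t" for r
    using in\<Omega>[of \<xi> r] \<xi> that sub by (intro DERIV_along_line d2) auto
  from MVT2[OF t this] obtain \<eta> where \<eta>: "0 < \<eta>" "\<eta> < t"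
    and 2: "dird v f (x + \<xi> *\<^sub>R v + t *\<^sub>R w) - dird v f (x + \<xi> *\<^sub>R v)
      = t * dird w (dird v f) (x + \<xi> *\<^sub>R v + \<eta> *\<^sub>R w)"
    by auto
  show ?thesis
    using 1 2 in\<Omega>[of \<xi> \<eta>] \<xi> \<eta>
    by (intro exI[of _ "x + \<xi> *\<^sub>R v + \<eta> *\<^sub>R w"]) (auto simp: power2_eq_square)
qed

lemma dird_commute:
  fixes f :: "real ^ 'N \<Rightarrow> real"
  assumes op: "open \<Omega>" and f: "cont_diff_on 2 \<Omega> f" and x: "x \<in> \<Omega>"
  shows "dird v (dird w f) x = dird w (dird v f) x"
proof (rule ccontr)
  assume ne: "dird v (dird w f) x \<noteq> dird w (dird v f) x"
  have cont: "isCont (dird u (dird u' f)) x" for u u'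
    using f op x by (auto simp: numeral_2_eq_2 cont_diff_on_Suc continuous_on_eq_continuous_at)
  \<comment> \<open>Half the gap, so that the \<epsilon>-neighbourhoods of the two values are
    disjoint.\<close>
  define \<epsilon> where "\<epsilon> = \<bar>dird v (dird w f) x - dird w (dird v f) x\<bar> / 2"
  have "\<epsilon> > 0" using ne by (simp add: \<epsilon>_def)
  obtain d1 where d1: "d1 > 0" "\<And>y. dist y x < d1 \<Longrightarrow> dist (dird v (dird w f) y) (dird v (dird w f) x) < \<epsilon>"
    using cont[of v w] \<open>\<epsilon> > 0\<close> unfolding continuous_at_eps_delta by metis
  obtain d2 where d2: "d2 > 0" "\<And>y. dist y x < d2 \<Longrightarrow> dist (dird w (dird v f) y) (dird w (dird v f) x) < \<epsilon>"
    using cont[of w v] \<open>\<epsilon> > 0\<close> unfolding continuous_at_eps_delta by metis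
  obtain d3 where d3: "d3 > 0" "cball x d3 \<subseteq> \<Omega>"
    using op x open_contains_cball by blast
  define d where "d = min (min d1 d2) d3 / 2"
  \<comment> \<open>The added 1 avoids division by 0 when v and w both vanish.\<close>
  define t where "t = d / (norm v + norm w + 1)"
  have d: "d > 0" "d < d1" "d < d2" "d < d3" using d1 d2 d3 by (auto simp: d_def)
  then have "t > 0" by (simp add: t_def add_nonneg_pos)
  have le: "t * (norm v + norm w) \<le> d"
    using d(1) by (simp add: t_def divide_simps add_nonneg_pos mult_left_mono)
  then have sub: "cball x (t * (norm v + norm w)) \<subseteq> \<Omega>"
    using d d3 by (meson less_eq_real_def order_trans subset_cball subset_trans)
  obtain y where y: "dist x y \<le> t * (norm v + norm w)"
    "f (x + t *\<^sub>R v + t *\<^sub>R w) - f (x + t *\<^sub>R v) - f (x + t *\<^sub>R w) + f x = t\<^sup>2 * dird w (dird v f) y"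
    using second_difference_mean_value[OF f \<open>t > 0\<close> sub] by blast
  obtain z where z: "dist x z \<le> t * (norm v + norm w)"
    "f (x + t *\<^sub>R w + t *\<^sub>R v) - f (x + t *\<^sub>R w) - f (x + t *\<^sub>R v) + f x = t\<^sup>2 * dird v (dird w f) z"
    using second_difference_mean_value[OF f \<open>t > 0\<close>, of x w v] sub
    unfolding add.commute[of "norm w"] by blast
  have "t\<^sup>2 * dird w (dird v f) y = t\<^sup>2 * dird v (dird w f) z"
    using y(2) z(2) by (simp add: algebra_simps)
  then have "dird w (dird v f) y = dird v (dird w f) z"
    using \<open>t > 0\<close> by simp
  moreover have "dist (dird w (dird v f) y) (dird w (dird v f) x) < \<epsilon>"
    using d2(2)[of y] y(1) le d by (simp add: dist_commute)
  moreover have "dist (dird v (dird w f) z) (dird v (dird w f) x) < \<epsilon>"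
    using d1(2)[of z] z(1) le d by (simp add: dist_commute)
  ultimately show False
    by (auto simp: dist_real_def \<epsilon>_def abs_if split: if_splits)
qed

text \<open>The homogeneous Taylor component of degree j at a, without multi-indices: by Euler's
  relation, j times this component is the sum of (x - a)_i times its i-th partial derivative, and
  that derivative is the component of degree j - 1 of the i-th partial derivative of f.\<close>

primrec taylor_form :: "nat \<Rightarrow> real ^ 'N \<Rightarrow> (real ^ 'N \<Rightarrow> real) \<Rightarrow> real ^ 'N \<Rightarrow> real" where
  "taylor_form 0 a f x = f a"
| "taylor_form (Suc j) a f x =
     (\<Sum>i\<in>UNIV. (x - a) $ i * taylor_form j a (dird (axis i 1) f) x) / real (Suc j)"

lemma taylor_form_polynomial: "real_polynomial_function (taylor_form j a f)"
proof (induction j arbitrary: f)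
  case 0
  show ?case by (simp add: real_polynomial_function.intros)
next
  case (Suc j)
  have "real_polynomial_function (\<lambda>x::real^'b. x $ i)" for i
    by (intro real_polynomial_function.intros bounded_linear_vec_nth)
  then have "real_polynomial_function (\<lambda>x. (x - a) $ i * taylor_form j a (dird (axis i 1) f) x)" for i
    using Suc by (auto intro!: real_polynomial_function.intros(4) real_polynomial_function_diff
      real_polynomial_function.intros(2))
  then show ?case
    unfolding taylor_form.simps(2)[abs_def]
    by (intro real_polynomial_function_divide real_polynomial_function_sum) auto
qed

lemma taylor_form_differentiable: "taylor_form j a f differentiable (at x)"
  using cont_diff_on_differentiable[OF open_UNIV cont_diff_on_polynomial[OF open_UNIV
    taylor_form_polynomial], of 1] by simp

context
  fixes \<Omega> :: "(real ^ 'N) set" and a :: "real ^ 'N"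
  assumes op: "open \<Omega>" and a: "a \<in> \<Omega>"
begin

lemma taylor_form_cong:
  "(\<And>y. y \<in> \<Omega> \<Longrightarrow> f y = g y) \<Longrightarrow> taylor_form j a f x = taylor_form j a g x"
proof (induction j arbitrary: f g)
  case (Suc j)
  have "taylor_form j a (dird v f) x = taylor_form j a (dird v g) x" for v
    by (rule Suc.IH) (rule dird_cong[OF op _ Suc.prems])
  then show ?case by simp
qed (use a in simp)

lemma taylor_form_sum:
  "finite I \<Longrightarrow> (\<And>i. i \<in> I \<Longrightarrow> cont_diff_on j \<Omega> (f i)) \<Longrightarrow>
   taylor_form j a (\<lambda>y. \<Sum>i\<in>I. c i * f i y) x = (\<Sum>i\<in>I. c i * taylor_form j a (f i) x)"
proof (induction j arbitrary: f)
  case (Suc j)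
  have "taylor_form j a (dird v (\<lambda>y. \<Sum>i\<in>I. c i * f i y)) x
      = (\<Sum>i\<in>I. c i * taylor_form j a (dird v (f i)) x)" for v
  proof (subst Suc.IH[symmetric])
    show "cont_diff_on j \<Omega> (dird v (f i))" if "i \<in> I" for i
      using Suc.prems(2)[OF that] by (simp add: cont_diff_on_Suc)
    show "taylor_form j a (dird v (\<lambda>y. \<Sum>i\<in>I. c i * f i y)) x
       = taylor_form j a (\<lambda>y. \<Sum>i\<in>I. c i * dird v (f i) y) x"
    proof (rule taylor_form_cong)
      fix y assume "y \<in> \<Omega>"
      then have "f i differentiable (at y)" if "i \<in> I" for i
        using Suc.prems(2)[OF that] by (simp add: cont_diff_on_Suc)
      then show "dird v (\<lambda>y. \<Sum>i\<in>I. c i * f i y) y = (\<Sum>i\<in>I. c i * dird v (f i) y)"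
        using Suc.prems(1) by (subst dird_sum) (auto simp: dird_cmult)
    qed
  qed (use Suc.prems in auto)
  then show ?case
    by (simp add: sum_distrib_left sum_divide_distrib mult.left_commute sum.swap[of _ I])
qed simp

text \<open>The product rule turns the recursion into one sum with v_i and one with (x - a)_i. The
  first is the form of \<open>dird v f\<close> by linearity; the second, after interchanging
  \<open>dird v\<close> with the partial derivatives, is a multiple of the same form by the
  recursion. The multiples add up to the denominator.\<close>

lemma dird_taylor_form:
  "cont_diff_on (Suc j) \<Omega> f \<Longrightarrow> dird v (taylor_form (Suc j) a f) x = taylor_form j a (dird v f) x"
proof (induction j arbitrary: f)
  case 0
  have "dird v (taylor_form (Suc 0) a f) x = (\<Sum>i\<in>UNIV. dird v (\<lambda>x. (x - a) $ i * dird (axis i 1) f a) x)"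
    by (simp add: taylor_form.simps(2)[abs_def] del: vector_minus_component)
       (intro dird_sum, auto)
  also have "\<dots> = (\<Sum>i\<in>UNIV. v $ i * dird (axis i 1) f a)"
    by (intro sum.cong refl) (simp add: dird_mult dird_diff)
  also have "\<dots> = dird v f a"
    using 0 a by (subst (2) dird_expand) (auto simp: cont_diff_on_Suc)
  finally show ?case by (simp del: taylor_form.simps(2))
next
  case (Suc j)
  let ?e = "\<lambda>i. axis i 1 :: real ^ 'N"
  have D: "cont_diff_on (Suc j) \<Omega> (dird u f)" for u
    using Suc.prems by (auto simp: cont_diff_on_Suc)
  have D2: "cont_diff_on 2 \<Omega> f"
    using cont_diff_on_mono[OF op Suc.prems, of 2] by simp
  have "dird v (taylor_form (Suc (Suc j)) a f) x
      = (\<Sum>i\<in>UNIV. dird v (\<lambda>x. (x - a) $ i * taylor_form (Suc j) a (dird (?e i) f) x) x) / real (Suc (Suc j))"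
    (is "_ = ?S / _")
  proof -
    have "dird v (taylor_form (Suc (Suc j)) a f) x = dird v (\<lambda>x. inverse (real (Suc (Suc j))) *
       (\<Sum>i\<in>UNIV. (x - a) $ i * taylor_form (Suc j) a (dird (?e i) f) x)) x"
      by (rule arg_cong[where f = "\<lambda>g. dird v g x"])
         (simp only: taylor_form.simps(2)[of "Suc j"] divide_inverse fun_eq_iff mult.commute simp_thms)
    also have "\<dots> = inverse (real (Suc (Suc j))) * ?S"
      by (subst dird_cmult) (auto intro!: dird_sum differentiable_sum differentiable_mult
          taylor_form_differentiable simp del: taylor_form.simps)
    finally show ?thesis by (simp add: divide_inverse mult.commute)
  qed
  also have "?S = (\<Sum>i\<in>UNIV. v $ i * taylor_form (Suc j) a (dird (?e i) f) x +
       (x - a) $ i * taylor_form j a (dird (?e i) (dird v f)) x)"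
  proof (intro sum.cong refl)
    fix i
    have "dird v (taylor_form (Suc j) a (dird (?e i) f)) x = taylor_form j a (dird v (dird (?e i) f)) x"
      by (rule Suc.IH[OF D])
    also have "\<dots> = taylor_form j a (dird (?e i) (dird v f)) x"
      by (rule taylor_form_cong) (rule dird_commute[OF op D2])
    finally show "dird v (\<lambda>x. (x - a) $ i * taylor_form (Suc j) a (dird (?e i) f) x) x =
      v $ i * taylor_form (Suc j) a (dird (?e i) f) x + (x - a) $ i * taylor_form j a (dird (?e i) (dird v f)) x"
      by (subst dird_mult) (auto simp: dird_diff taylor_form_differentiable simp del: taylor_form.simps)
  qed
  also have "\<dots> = (\<Sum>i\<in>UNIV. v $ i * taylor_form (Suc j) a (dird (?e i) f) x)
      + real (Suc j) * taylor_form (Suc j) a (dird v f) x"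
    by (simp add: sum.distrib)
  also have "(\<Sum>i\<in>UNIV. v $ i * taylor_form (Suc j) a (dird (?e i) f) x)
      = taylor_form (Suc j) a (dird v f) x"
  proof -
    have "taylor_form (Suc j) a (dird v f) x
        = taylor_form (Suc j) a (\<lambda>y. \<Sum>i\<in>UNIV. v $ i * dird (?e i) f y) x"
      by (rule taylor_form_cong) (use Suc.prems in \<open>simp add: cont_diff_on_Suc dird_expand[of f _ v]\<close>)
    also have "\<dots> = (\<Sum>i\<in>UNIV. v $ i * taylor_form (Suc j) a (dird (?e i) f) x)"
      by (rule taylor_form_sum) (use D in auto)
    finally show ?thesis by simp
  qed
  also have "taylor_form (Suc j) a (dird v f) x + real (Suc j) * taylor_form (Suc j) a (dird v f) x
      = real (Suc (Suc j)) * taylor_form (Suc j) a (dird v f) x"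
    by (simp del: taylor_form.simps add: algebra_simps)
  finally show ?case by (simp del: taylor_form.simps)
qed

end

definition taylor_poly :: "nat \<Rightarrow> real ^ 'N \<Rightarrow> (real ^ 'N \<Rightarrow> real) \<Rightarrow> real ^ 'N \<Rightarrow> real" where
  "taylor_poly k a f = (\<lambda>x. \<Sum>j\<le>k. taylor_form j a f x)"

lemma taylor_poly_polynomial: "real_polynomial_function (taylor_poly k a f)"
  unfolding taylor_poly_def by (intro real_polynomial_function_sum taylor_form_polynomial) auto

lemma dird_taylor_poly:
  fixes f :: "real ^ 'N \<Rightarrow> real"
  assumes op: "open \<Omega>" and a: "a \<in> \<Omega>" and f: "cont_diff_on (Suc k) \<Omega> f"
  shows "dird v (taylor_poly (Suc k) a f) x = taylor_poly k a (dird v f) x"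
proof -
  have "dird v (taylor_form (Suc j) a f) x = taylor_form j a (dird v f) x" if "j \<le> k" for j
    using cont_diff_on_mono[OF op f, of "Suc j"] that by (intro dird_taylor_form[OF op a]) simp
  then have *: "(\<Sum>j\<le>k. dird v (taylor_form (Suc j) a f) x) = (\<Sum>j\<le>k. taylor_form j a (dird v f) x)"
    by (intro sum.cong) auto
  have "dird v (taylor_poly (Suc k) a f) x = (\<Sum>j\<le>Suc k. dird v (taylor_form j a f) x)"
    unfolding taylor_poly_def by (intro dird_sum taylor_form_differentiable) simp
  also have "\<dots> = dird v (taylor_form 0 a f) x + (\<Sum>j\<le>k. dird v (taylor_form (Suc j) a f) x)"
    by (rule sum.atMost_Suc_shift)
  also have "dird v (taylor_form 0 a f) x = 0"
    by (simp add: taylor_form.simps(1)[abs_def])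
  finally show ?thesis
    using * by (simp add: taylor_poly_def del: taylor_form.simps)
qed

subsection \<open>Functions with vanishing jet\<close>

text \<open>Vanishing of the m-jet at a. The recursion runs over the same directional derivatives as
  \<open>cont_diff_on\<close>, so both properties pass to \<open>dird v f\<close> together.\<close>

primrec flat :: "nat \<Rightarrow> real ^ 'N \<Rightarrow> (real ^ 'N \<Rightarrow> real) \<Rightarrow> bool" where
  "flat 0 a f \<longleftrightarrow> f a = 0"
| "flat (Suc m) a f \<longleftrightarrow> f a = 0 \<and> (\<forall>v. flat m a (dird v f))"

lemma flat_zero: "flat m a f \<Longrightarrow> f a = 0"
  by (cases m) auto

lemma flat_cong:
  assumes "open \<Omega>" "a \<in> \<Omega>"
  shows "flat m a f \<Longrightarrow> (\<And>x. x \<in> \<Omega> \<Longrightarrow> f x = g x) \<Longrightarrow> flat m a g"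
proof (induction m arbitrary: f g)
  case 0
  then show ?case using assms(2) by simp
next
  case (Suc m)
  have "flat m a (dird v g)" for v
  proof (rule Suc.IH)
    show "flat m a (dird v f)" using Suc.prems(1) by simp
    show "dird v f x = dird v g x" if "x \<in> \<Omega>" for x
      by (rule dird_cong[OF assms(1) that Suc.prems(2)])
  qed
  moreover have "g a = 0" using Suc.prems(1) Suc.prems(2)[OF assms(2)] by simp
  ultimately show ?case by simp
qed

lemma flat_taylor_remainder:
  fixes f :: "real ^ 'N \<Rightarrow> real"
  assumes op: "open \<Omega>" and a: "a \<in> \<Omega>"
  shows "cont_diff_on k \<Omega> f \<Longrightarrow> flat k a (\<lambda>x. f x - taylor_poly k a f x)"
proof (induction k arbitrary: f)
  case 0
  then show ?case by (simp add: taylor_poly_def)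
next
  case (Suc k)
  have "flat k a (dird v (\<lambda>x. f x - taylor_poly (Suc k) a f x))" for v
  proof (rule flat_cong[OF op a])
    show "flat k a (\<lambda>x. dird v f x - taylor_poly k a (dird v f) x)"
      using Suc.prems by (intro Suc.IH) (simp add: cont_diff_on_Suc)
    have "taylor_poly (Suc k) a f differentiable (at x)" for x
      using cont_diff_on_differentiable[OF open_UNIV cont_diff_on_polynomial[OF open_UNIV
        taylor_poly_polynomial], of 1] by simp
    then show "dird v f x - taylor_poly k a (dird v f) x = dird v (\<lambda>x. f x - taylor_poly (Suc k) a f x) x"
      if "x \<in> \<Omega>" for x
      using Suc.prems that
      by (subst dird_diff) (auto simp: cont_diff_on_Suc dird_taylor_poly[OF op a Suc.prems])
  qed
  moreover have "taylor_poly (Suc k) a f a = f a"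
    by (simp add: taylor_poly_def sum.atMost_Suc_shift del: sum.atMost_Suc)
  ultimately show ?case by simp
qed

text \<open>The Peano remainder: the mean value theorem on the segment from a to x reduces f to its
  partial derivatives, which are flat of one order less. Continuity of the derivatives of order m
  gives the small constant \<epsilon> at the bottom of the induction.\<close>

lemma flat_bound:
  fixes f :: "real ^ 'N \<Rightarrow> real"
  assumes op: "open \<Omega>" and a: "a \<in> \<Omega>"
  shows "cont_diff_on m \<Omega> f \<Longrightarrow> flat m a f \<Longrightarrow> \<epsilon> > 0 \<Longrightarrow>
    \<exists>\<delta>>0. ball a \<delta> \<subseteq> \<Omega> \<and> (\<forall>x\<in>ball a \<delta>. \<bar>f x\<bar> \<le> \<epsilon> * norm (x - a) ^ m)"
proof (induction m arbitrary: f \<epsilon>)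
  case 0
  obtain d1 where d1: "d1 > 0" "ball a d1 \<subseteq> \<Omega>" using op a open_contains_ball by blast
  have "isCont f a" using 0 op a by (auto simp: continuous_on_eq_continuous_at)
  then obtain d2 where d2: "d2 > 0" "\<And>x. dist x a < d2 \<Longrightarrow> dist (f x) (f a) < \<epsilon>"
    using 0(3) unfolding continuous_at_eps_delta by metis
  have "\<bar>f x\<bar> \<le> \<epsilon>" if "dist a x < d2" for x
    using d2(2)[of x] that 0 by (simp add: dist_real_def dist_commute)
  then show ?case
    using d1 d2(1) by (intro exI[of _ "min d1 d2"]) auto
next
  case (Suc m)
  let ?e = "\<lambda>i. axis i 1 :: real ^ 'N" and ?N = "real CARD('N)"
  \<comment> \<open>The division by the dimension compensates the sum over all coordinates in the
    final estimate.\<close>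
  have "\<exists>\<delta>>0. ball a \<delta> \<subseteq> \<Omega> \<and> (\<forall>x\<in>ball a \<delta>. \<bar>dird (?e i) f x\<bar> \<le> (\<epsilon> / ?N) * norm (x - a) ^ m)" for i
    using Suc.prems by (intro Suc.IH) (auto simp: cont_diff_on_Suc)
  then obtain d where d: "\<And>i. d i > 0" "\<And>i. ball a (d i) \<subseteq> \<Omega>"
    "\<And>i x. x \<in> ball a (d i) \<Longrightarrow> \<bar>dird (?e i) f x\<bar> \<le> (\<epsilon> / ?N) * norm (x - a) ^ m"
    by metis
  define \<delta> where "\<delta> = Min (range d)"
  have \<delta>: "\<delta> > 0" "\<And>i. \<delta> \<le> d i" using d(1) by (auto simp: \<delta>_def)
  have sub: "ball a \<delta> \<subseteq> \<Omega>" using d(2) \<delta>(2) by (meson subset_ball subset_trans)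
  have "\<bar>f x\<bar> \<le> \<epsilon> * norm (x - a) ^ Suc m" if x: "x \<in> ball a \<delta>" for x
  proof -
    have seg: "a + s *\<^sub>R (x - a) \<in> ball a \<delta>" if "0 \<le> s" "s \<le> 1" for s
    proof -
      have "norm (s *\<^sub>R (x - a)) \<le> norm (x - a)"
        using that by (simp add: mult_left_le_one_le)
      with x show ?thesis by (simp add: dist_norm norm_minus_commute)
    qed
    have df: "f differentiable (at y)" if "y \<in> \<Omega>" for y
      using Suc.prems that by (simp add: cont_diff_on_Suc)
    have "((\<lambda>s. f (a + s *\<^sub>R (x - a))) has_real_derivative dird (x - a) f (a + s *\<^sub>R (x - a))) (at s)"
      if "0 \<le> s" "s \<le> 1" for s
      using seg[OF that] sub by (intro DERIV_along_line df) auto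
    from MVT2[OF zero_less_one this] obtain s where s: "0 < s" "s < 1"
      "f x - f a = dird (x - a) f (a + s *\<^sub>R (x - a))"
      by auto
    define y where "y = a + s *\<^sub>R (x - a)"
    have y: "y \<in> ball a \<delta>" "norm (y - a) \<le> norm (x - a)"
      using seg[of s] s by (auto simp: y_def mult_left_le_one_le)
    have "\<bar>f x\<bar> = \<bar>dird (x - a) f y\<bar>" using s Suc.prems by (simp add: y_def)
    also have "\<dots> = \<bar>\<Sum>i\<in>UNIV. (x - a) $ i * dird (?e i) f y\<bar>"
      using y(1) sub by (subst dird_expand) (auto intro: df)
    also have "\<dots> \<le> (\<Sum>i\<in>UNIV. \<bar>(x - a) $ i * dird (?e i) f y\<bar>)"
      by (rule sum_abs)
    also have "\<dots> \<le> (\<Sum>i\<in>(UNIV::'N set). norm (x - a) * ((\<epsilon> / ?N) * norm (x - a) ^ m))"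
    proof (rule sum_mono)
      fix i :: 'N
      have "\<bar>dird (?e i) f y\<bar> \<le> (\<epsilon> / ?N) * norm (y - a) ^ m"
        using y(1) \<delta>(2)[of i] by (intro d(3)) auto
      also have "\<dots> \<le> (\<epsilon> / ?N) * norm (x - a) ^ m"
        using y(2) Suc.prems by (intro mult_left_mono power_mono) auto
      finally show "\<bar>(x - a) $ i * dird (?e i) f y\<bar> \<le> norm (x - a) * ((\<epsilon> / ?N) * norm (x - a) ^ m)"
        using component_le_norm_cart[of "x - a" i] by (simp only: abs_mult) (intro mult_mono, auto)
    qed
    also have "\<dots> = \<epsilon> * norm (x - a) ^ Suc m" by simp
    finally show ?thesis .
  qed
  with \<delta> sub show ?case by blast
qed

subsection \<open>Multipliers that are homogeneous about a point\<close>

text \<open>The estimates of a function homogeneous of degree e about a: its derivatives of order j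
  are O(norm (x - a) powr (e - j)) for j up to i. Nothing is required at a itself.\<close>

primrec growth :: "nat \<Rightarrow> real ^ 'N \<Rightarrow> real \<Rightarrow> (real ^ 'N \<Rightarrow> real) \<Rightarrow> bool" where
  "growth 0 a e g \<longleftrightarrow> (\<exists>C. \<forall>x. x \<noteq> a \<longrightarrow> \<bar>g x\<bar> \<le> C * norm (x - a) powr e)"
| "growth (Suc i) a e g \<longleftrightarrow> (\<exists>C. \<forall>x. x \<noteq> a \<longrightarrow> \<bar>g x\<bar> \<le> C * norm (x - a) powr e) \<and>
     (\<forall>v. growth i a (e - 1) (dird v g))"

lemma growth_bound:
  assumes "growth i a e g"
  obtains C where "C > 0" "\<And>x. x \<noteq> a \<Longrightarrow> \<bar>g x\<bar> \<le> C * norm (x - a) powr e"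
proof -
  obtain C where C: "\<And>x. x \<noteq> a \<Longrightarrow> \<bar>g x\<bar> \<le> C * norm (x - a) powr e"
    using assms by (cases i) auto
  have "\<bar>g x\<bar> \<le> (\<bar>C\<bar> + 1) * norm (x - a) powr e" if "x \<noteq> a" for x
    by (rule order_trans[OF C[OF that]]) (intro mult_right_mono, auto)
  then show thesis using that[of "\<bar>C\<bar> + 1"] by auto
qed

lemma growth_SucD: "growth (Suc i) a e g \<Longrightarrow> growth i a e g"
  by (induction i arbitrary: e g) auto

lemma growth_cong: "growth i a e f \<Longrightarrow> (\<And>x. x \<noteq> a \<Longrightarrow> f x = g x) \<Longrightarrow> growth i a e g"
proof (induction i arbitrary: e f g)
  case (Suc i)
  have "growth i a (e - 1) (dird v g)" for v
  proof (rule Suc.IH)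
    show "growth i a (e - 1) (dird v f)" using Suc.prems by simp
    show "dird v f x = dird v g x" if "x \<noteq> a" for x
      by (rule dird_cong[of "- {a}"]) (use Suc.prems that in auto)
  qed
  with Suc.prems show ?case by auto
qed auto

lemma growth_const0 [simp]: "growth i a e (\<lambda>x. 0)"
  by (induction i arbitrary: e) (auto simp: dird_const[abs_def] intro!: exI[of _ 0])

lemma growth_0: "growth i a e g \<Longrightarrow> growth 0 a e g"
  by (cases i) auto

lemma growth_Suc: "growth (Suc i) a e g \<longleftrightarrow> growth 0 a e g \<and> (\<forall>v. growth i a (e - 1) (dird v g))"
  by simp

lemma growth_0_add:
  assumes "growth 0 a e f" "growth 0 a e g"
  shows "growth 0 a e (\<lambda>x. f x + g x)"
proof -
  obtain C D where "\<And>x. x \<noteq> a \<Longrightarrow> \<bar>f x\<bar> \<le> C * norm (x - a) powr e"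
    "\<And>x. x \<noteq> a \<Longrightarrow> \<bar>g x\<bar> \<le> D * norm (x - a) powr e"
    using assms by auto
  then have "\<bar>f x + g x\<bar> \<le> (C + D) * norm (x - a) powr e" if "x \<noteq> a" for x
    unfolding distrib_right using that by (intro order_trans[OF abs_triangle_ineq] add_mono) auto
  then show ?thesis by auto
qed

lemma growth_0_mult:
  assumes "growth 0 a d f" "growth 0 a e g"
  shows "growth 0 a (d + e) (\<lambda>x. f x * g x)"
proof -
  obtain C D where C: "C > 0" "\<And>x. x \<noteq> a \<Longrightarrow> \<bar>f x\<bar> \<le> C * norm (x - a) powr d"
    and D: "D > 0" "\<And>x. x \<noteq> a \<Longrightarrow> \<bar>g x\<bar> \<le> D * norm (x - a) powr e"
    using growth_bound[OF assms(1)] growth_bound[OF assms(2)] by metis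
  have "\<bar>f x * g x\<bar> \<le> (C * D) * norm (x - a) powr (d + e)" if "x \<noteq> a" for x
    using mult_mono[OF C(2) D(2), OF that that] C(1) by (simp add: abs_mult powr_add ac_simps)
  then show ?thesis by auto
qed

context
  fixes a :: "real ^ 'N"
begin

lemma open_Compl_point: "open (- {a})"
  by (simp add: open_Compl)

lemma growth_add:
  "cont_diff_on i (- {a}) f \<Longrightarrow> cont_diff_on i (- {a}) g \<Longrightarrow> growth i a e f \<Longrightarrow> growth i a e g \<Longrightarrow>
   growth i a e (\<lambda>x. f x + g x)"
proof (induction i arbitrary: e f g)
  case 0
  then show ?case by (intro growth_0_add)
next
  case (Suc i)
  have "growth i a (e - 1) (dird v (\<lambda>x. f x + g x))" for v
    by (rule growth_cong[OF Suc.IH[of "dird v f" "dird v g" "e - 1"]])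
      (use Suc.prems in \<open>auto simp: cont_diff_on_Suc dird_add\<close>)
  moreover have "growth 0 a e (\<lambda>x. f x + g x)"
    by (intro growth_0_add growth_0[OF Suc.prems(3)] growth_0[OF Suc.prems(4)])
  ultimately show ?case unfolding growth_Suc by blast
qed

lemma growth_sum:
  "(\<And>j. j \<in> J \<Longrightarrow> cont_diff_on i (- {a}) (f j)) \<Longrightarrow> (\<And>j. j \<in> J \<Longrightarrow> growth i a e (f j)) \<Longrightarrow>
   growth i a e (\<lambda>x. \<Sum>j\<in>J. f j x)"
proof (induction J rule: infinite_finite_induct)
  case (insert j J)
  then show ?case
    using growth_add[of i "f j" "\<lambda>x. \<Sum>j\<in>J. f j x" e] cont_diff_on_sum[OF open_Compl_point, of J i f] by auto
qed auto

lemma growth_mult: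
  "cont_diff_on i (- {a}) f \<Longrightarrow> cont_diff_on i (- {a}) g \<Longrightarrow> growth i a d f \<Longrightarrow> growth i a e g \<Longrightarrow>
   growth i a (d + e) (\<lambda>x. f x * g x)"
proof (induction i arbitrary: d e f g)
  case 0
  then show ?case by (intro growth_0_mult)
next
  case (Suc i)
  have "growth i a (d + e - 1) (dird v (\<lambda>x. f x * g x))" for v
  proof (rule growth_cong)
    have c: "cont_diff_on i (- {a}) f" "cont_diff_on i (- {a}) g"
      "cont_diff_on i (- {a}) (dird v f)" "cont_diff_on i (- {a}) (dird v g)"
      using Suc.prems(1,2)[THEN cont_diff_on_SucD[OF open_Compl_point]] Suc.prems(1,2) by (auto simp: cont_diff_on_Suc)
    have gr: "growth i a (d - 1) (dird v f)" "growth i a (e - 1) (dird v g)"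
      using Suc.prems(3,4) by auto
    have "growth i a (d + (e - 1)) (\<lambda>x. f x * dird v g x)"
      by (intro Suc.IH c gr growth_SucD[OF Suc.prems(3)])
    moreover have "growth i a ((d - 1) + e) (\<lambda>x. dird v f x * g x)"
      by (intro Suc.IH c gr growth_SucD[OF Suc.prems(4)])
    ultimately show "growth i a (d + e - 1) (\<lambda>x. f x * dird v g x + dird v f x * g x)"
      using c by (intro growth_add cont_diff_on_mult[OF open_Compl_point]) (auto simp: algebra_simps)
    show "f x * dird v g x + dird v f x * g x = dird v (\<lambda>x. f x * g x) x" if "x \<noteq> a" for x
      using Suc.prems(1,2) that by (subst dird_mult) (auto simp: cont_diff_on_Suc)
  qed
  moreover have "growth 0 a (d + e) (\<lambda>x. f x * g x)"
    by (intro growth_0_mult growth_0[OF Suc.prems(3)] growth_0[OF Suc.prems(4)])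
  ultimately show ?case unfolding growth_Suc by blast
qed

lemma growth_const: "growth i a 0 (\<lambda>x. c)"
proof -
  have "\<bar>c\<bar> \<le> \<bar>c\<bar> * norm (x - a) powr 0" if "x \<noteq> a" for x
    using that by simp
  then show ?thesis
    by (cases i) (auto simp: dird_const[abs_def])
qed

lemma growth_cmult:
  "cont_diff_on i (- {a}) g \<Longrightarrow> growth i a e g \<Longrightarrow> growth i a e (\<lambda>x. c * g x)"
  using growth_mult[OF cont_diff_on_const[OF open_Compl_point] _ growth_const, of i g e c] by simp

text \<open>The derivative of 1/g is -(1/g)^2 g', with exponent -2e + (e - 1) = -e - 1.
  Differentiability and growth go through one induction since the product rule for
  \<open>growth\<close> needs both.\<close>

lemma growth_inverse:
  assumes c: "c > 0" and lower: "\<And>x. x \<noteq> a \<Longrightarrow> c * norm (x - a) powr e \<le> g x"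
  shows "cont_diff_on i (- {a}) g \<Longrightarrow> growth i a e g \<Longrightarrow>
    cont_diff_on i (- {a}) (\<lambda>x. inverse (g x)) \<and> growth i a (- e) (\<lambda>x. inverse (g x))"
proof -
  have pos: "g x > 0" if "x \<noteq> a" for x
    by (rule less_le_trans[OF _ lower[OF that]]) (use c that in auto)
  have "\<bar>inverse (g x)\<bar> \<le> inverse c * norm (x - a) powr (- e)" if "x \<noteq> a" for x
  proof -
    have "inverse (g x) \<le> inverse (c * norm (x - a) powr e)"
      using c that lower by (intro le_imp_inverse_le) auto
    then show ?thesis using pos[OF that] by (simp add: powr_minus)
  qed
  then have bd: "growth 0 a (- e) (\<lambda>x. inverse (g x))" by auto
  show "cont_diff_on i (- {a}) g \<Longrightarrow> growth i a e g \<Longrightarrow>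
    cont_diff_on i (- {a}) (\<lambda>x. inverse (g x)) \<and> growth i a (- e) (\<lambda>x. inverse (g x))"
  proof (induction i)
    case 0
    with bd pos show ?case by (auto intro!: continuous_intros) (metis less_irrefl)
  next
    case (Suc i)
    have IH: "cont_diff_on i (- {a}) (\<lambda>x. inverse (g x))" "growth i a (- e) (\<lambda>x. inverse (g x))"
      using Suc.IH[OF cont_diff_on_SucD[OF open_Compl_point Suc.prems(1)] growth_SucD[OF Suc.prems(2)]] by auto
    have Dg: "cont_diff_on i (- {a}) (dird v g)" "growth i a (e - 1) (dird v g)" for v
      using Suc.prems by (auto simp: cont_diff_on_Suc)
    have dg: "g differentiable (at x)" if "x \<noteq> a" for x
      using Suc.prems that by (auto simp: cont_diff_on_Suc)
    have inv: "(inverse has_real_derivative - (inverse (g x) * inverse (g x))) (at (g x))" if "x \<noteq> a" for x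
      using DERIV_inverse[of "g x" UNIV] pos[OF that] by (simp add: power2_eq_square)
    let ?D = "\<lambda>v x. - 1 * (inverse (g x) * (inverse (g x) * dird v g x))"
    have eq: "?D v x = dird v (\<lambda>x. inverse (g x)) x" if "x \<noteq> a" for v x
      using dird_DERIV(1)[OF dg inv, OF that that] by simp
    have diff: "(\<lambda>x. inverse (g x)) differentiable (at x)" if "x \<noteq> a" for x
      using dird_DERIV(2)[OF dg inv, OF that that] by simp
    have "growth i a (- e + (- e + (e - 1))) (?D v)" for v
      by (intro growth_cmult growth_mult cont_diff_on_mult[OF open_Compl_point] IH Dg)
    then have gr: "growth i a (- e - 1) (dird v (\<lambda>x. inverse (g x)))" for v
      by (intro growth_cong[OF _ eq]) auto
    have "cont_diff_on i (- {a}) (?D v)" for v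
      by (intro cont_diff_on_mult[OF open_Compl_point] cont_diff_on_const[OF open_Compl_point] IH Dg)
    then have cd: "cont_diff_on i (- {a}) (dird v (\<lambda>x. inverse (g x)))" for v
      by (rule cont_diff_on_cong[OF open_Compl_point]) (use eq in auto)
    show ?case
      unfolding growth_Suc using gr cd diff bd by (auto simp: cont_diff_on_Suc)
  qed
qed

lemma growth_pos_part:
  "i < q \<Longrightarrow> growth i a (real q) (\<lambda>x. max 0 (s * (x - a) $ j) ^ q)"
proof (induction i arbitrary: q)
  case 0
  have "\<bar>max 0 (s * (x - a) $ j) ^ q\<bar> \<le> \<bar>s\<bar> ^ q * norm (x - a) powr real q" if "x \<noteq> a" for x
  proof -
    have "max 0 (s * (x - a) $ j) \<le> \<bar>s\<bar> * norm (x - a)"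
      using mult_left_mono[OF component_le_norm_cart[of "x - a" j], of "\<bar>s\<bar>"]
      by (simp flip: abs_mult)
    then have "max 0 (s * (x - a) $ j) ^ q \<le> (\<bar>s\<bar> * norm (x - a)) ^ q"
      by (intro power_mono) auto
    then show ?thesis using that by (simp add: power_mult_distrib powr_realpow)
  qed
  then show ?case by auto
next
  case (Suc i)
  have bd: "growth 0 a (real q) (\<lambda>x. max 0 (s * (x - a) $ j) ^ q)"
    using growth_0[OF Suc.IH[of q]] Suc.prems by simp
  have lin: "cont_diff_on k U (\<lambda>x. s * (x - a) $ j)" if "open U" for k and U :: "(real ^ 'N) set"
    using that by (auto intro!: cont_diff_on_mult cont_diff_on_diff)
  have d: "(\<lambda>x. s * (x - a) $ j) differentiable (at x)" for x
    by auto
  have "growth i a (real q - 1) (dird v (\<lambda>x. max 0 (s * (x - a) $ j) ^ q))" for v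
  proof (rule growth_cong)
    have "growth i a (real (q - 1)) (\<lambda>x. (real q * (s * v $ j)) * max 0 (s * (x - a) $ j) ^ (q - 1))"
      using Suc.prems by (intro growth_cmult Suc.IH cont_diff_on_pos_part_power lin) auto
    then show "growth i a (real q - 1) (\<lambda>x. (real q * (s * v $ j)) * max 0 (s * (x - a) $ j) ^ (q - 1))"
      using Suc.prems by (simp add: of_nat_diff)
    show "(real q * (s * v $ j)) * max 0 (s * (x - a) $ j) ^ (q - 1)
        = dird v (\<lambda>x. max 0 (s * (x - a) $ j) ^ q) x" for x
      using Suc.prems
      by (subst dird_DERIV(1)[OF d DERIV_pos_part_power]) (auto simp: dird_cmult dird_diff)
  qed
  with bd show ?case unfolding growth_Suc by blast
qed

end

text \<open>Near a, f is o(norm (x - a) ^ m), so f g is o(norm (x - a) powr (m + e)) with m + e at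
  least i. By the product rule a derivative lowers i by 1 and either m or e by 1, so this inequality
  is preserved.\<close>

lemma flat_times_growth:
  fixes f :: "real ^ 'N \<Rightarrow> real"
  assumes op: "open \<Omega>" and a: "a \<in> \<Omega>"
  shows "cont_diff_on m \<Omega> f \<Longrightarrow> flat m a f \<Longrightarrow> cont_diff_on i (- {a}) g \<Longrightarrow> growth i a e g \<Longrightarrow>
    real i \<le> real m + e \<Longrightarrow> i \<le> m \<Longrightarrow> cont_diff_on i \<Omega> (\<lambda>x. f x * g x)"
proof (induction i arbitrary: m e f g)
  case 0
  have bd: "\<exists>\<delta>>0. \<forall>x. dist x a < \<delta> \<longrightarrow> \<bar>f x * g x\<bar> < \<epsilon>" if "\<epsilon> > 0" for \<epsilon>
  proof -
    obtain C where C: "C > 0" "\<And>x. x \<noteq> a \<Longrightarrow> \<bar>g x\<bar> \<le> C * norm (x - a) powr e"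
      using growth_bound[OF 0(4)] by metis
    obtain d where d: "d > 0" "\<And>x. x \<in> ball a d \<Longrightarrow> \<bar>f x\<bar> \<le> (\<epsilon> / (2 * C)) * norm (x - a) ^ m"
      using flat_bound[OF op a 0(1,2), of "\<epsilon> / (2 * C)"] C(1) \<open>\<epsilon> > 0\<close> by auto
    have "\<bar>f x * g x\<bar> < \<epsilon>" if x: "dist x a < min d 1" for x
    proof (cases "x = a")
      case True
      then show ?thesis using flat_zero[OF 0(2)] \<open>\<epsilon> > 0\<close> by simp
    next
      case False
      have "\<bar>f x * g x\<bar> \<le> ((\<epsilon> / (2 * C)) * norm (x - a) ^ m) * (C * norm (x - a) powr e)"
        unfolding abs_mult using x False C \<open>\<epsilon> > 0\<close> by (intro mult_mono d(2)) (auto simp: dist_commute)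
      also have "\<dots> = (\<epsilon> / 2) * norm (x - a) powr (real m + e)"
        using False C(1) by (simp add: powr_add powr_realpow)
      also have "\<dots> \<le> (\<epsilon> / 2) * 1"
        using x False 0(5) \<open>\<epsilon> > 0\<close> by (intro mult_left_mono powr_le1) (auto simp: dist_norm)
      finally show ?thesis using \<open>\<epsilon> > 0\<close> by simp
    qed
    then show ?thesis using d(1) by (intro exI[of _ "min d 1"]) auto
  qed
  have "isCont (\<lambda>x. f x * g x) x" if "x \<in> \<Omega>" for x
  proof (cases "x = a")
    case True
    then show ?thesis
      using bd flat_zero[OF 0(2)] by (simp add: continuous_at_eps_delta dist_real_def)
  next
    case False
    then have "isCont g x"
      using 0(3) continuous_on_eq_continuous_at[of "- {a}" g] by (simp add: open_Compl)
    then show ?thesis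
      using cont_diff_on_continuous[OF op 0(1)] that op
      by (intro continuous_mult) (auto simp: continuous_on_eq_continuous_at)
  qed
  then show ?case using op by (simp add: continuous_on_eq_continuous_at)
next
  case (Suc i)
  obtain n where m: "m = Suc n" using Suc.prems(6) by (cases m) auto
  have fa: "f a = 0" "\<And>v. dird v f a = 0"
    using Suc.prems(2) flat_zero by (auto simp: m)
  have Df: "cont_diff_on n \<Omega> (dird v f)" "flat n a (dird v f)" for v
    using Suc.prems by (auto simp: m cont_diff_on_Suc)
  have df: "f differentiable (at x)" if "x \<in> \<Omega>" for x
    using Suc.prems that by (auto simp: m cont_diff_on_Suc)
  have dg: "g differentiable (at x)" if "x \<noteq> a" for x
    using Suc.prems that by (auto simp: cont_diff_on_Suc)
  obtain C where C: "C > 0" "\<And>x. x \<noteq> a \<Longrightarrow> \<bar>g x\<bar> \<le> C * norm (x - a) powr e"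
    using growth_bound[OF Suc.prems(4)] by metis
  \<comment> \<open>Since m + e is at least 1, f g is o(norm (x - a)), so the derivative at a exists
    and is 0 although g may be discontinuous there.\<close>
  have at_a: "((\<lambda>x. f x * g x) has_derivative (\<lambda>_. 0)) (at a)"
  proof (rule has_derivativeI_sandwich[where H = "\<lambda>x. if x = a then 0 else \<bar>f x * g x\<bar> / norm (x - a)" and e = 1])
    have "\<exists>\<delta>>0. \<forall>x. x \<noteq> a \<and> dist x a < \<delta> \<longrightarrow> \<bar>f x * g x\<bar> / norm (x - a) < \<epsilon>" if "\<epsilon> > 0" for \<epsilon>
    proof -
      obtain d where d: "d > 0" "\<And>x. x \<in> ball a d \<Longrightarrow> \<bar>f x\<bar> \<le> (\<epsilon> / (2 * C)) * norm (x - a) ^ m"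
        using flat_bound[OF op a Suc.prems(1,2), of "\<epsilon> / (2 * C)"] C(1) \<open>\<epsilon> > 0\<close> by auto
      have "\<bar>f x * g x\<bar> / norm (x - a) < \<epsilon>" if x: "x \<noteq> a" "dist x a < min d 1" for x
      proof -
        have "\<bar>f x * g x\<bar> \<le> ((\<epsilon> / (2 * C)) * norm (x - a) ^ m) * (C * norm (x - a) powr e)"
          unfolding abs_mult using x C \<open>\<epsilon> > 0\<close> by (intro mult_mono d(2)) (auto simp: dist_commute)
        also have "\<dots> = (\<epsilon> / 2) * norm (x - a) powr (real m + e)"
          using x C(1) by (simp add: powr_add powr_realpow)
        also have "\<dots> \<le> (\<epsilon> / 2) * norm (x - a) powr 1"
          using x Suc.prems(5) \<open>\<epsilon> > 0\<close> by (intro mult_left_mono powr_mono') (auto simp: dist_norm)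
        finally show ?thesis using \<open>\<epsilon> > 0\<close> x by (simp add: divide_simps)
          (smt (verit) mult_pos_pos zero_less_norm_iff eq_iff_diff_eq_0)
      qed
      then show ?thesis using d(1) by (intro exI[of _ "min d 1"]) auto
    qed
    then show "((\<lambda>x. if x = a then 0 else \<bar>f x * g x\<bar> / norm (x - a)) \<longlongrightarrow> 0) (at a within UNIV)"
      by (auto simp: LIM_def dist_real_def)
  qed (use fa in auto)
  have diff: "(\<lambda>x. f x * g x) differentiable (at x)" if "x \<in> \<Omega>" for x
    using at_a df[OF that] dg by (cases "x = a") (auto intro: differentiable_mult differentiableI)
  \<comment> \<open>At a the unspecified values of g and \<open>dird v g\<close> are multiplied by
    \<open>dird v f a = 0\<close> and \<open>f a = 0\<close>.\<close>
  have eq: "f x * dird v g x + dird v f x * g x = dird v (\<lambda>x. f x * g x) x" if "x \<in> \<Omega>" for x v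
    using dird_eq[OF at_a] df[OF that] dg fa by (cases "x = a") (auto simp: dird_mult)
  have "cont_diff_on i \<Omega> (\<lambda>x. f x * dird v g x)" for v
    using Suc.prems by (intro Suc.IH[of m f _ "e - 1"]) (auto simp: cont_diff_on_Suc)
  moreover have "cont_diff_on i \<Omega> (\<lambda>x. dird v f x * g x)" for v
    using Suc.prems(5,6) cont_diff_on_SucD[OF _ Suc.prems(3)] growth_SucD[OF Suc.prems(4)]
    by (intro Suc.IH[of n _ _ e] Df) (auto simp: m)
  ultimately have "cont_diff_on i \<Omega> (\<lambda>x. f x * dird v g x + dird v f x * g x)" for v
    by (intro cont_diff_on_add[OF op])
  then have "cont_diff_on i \<Omega> (dird v (\<lambda>x. f x * g x))" for v
    by (rule cont_diff_on_cong[OF op]) (rule eq)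
  with diff show ?case by (simp add: cont_diff_on_Suc)
qed

text \<open>
  The summands arise by multiplying with the powers of the positive and negative parts of the
  coordinates, normalised to have sum 1.
\<close>

lemma flat_decomposition:
  fixes f :: "real ^ 'N \<Rightarrow> real"
  assumes op: "open \<Omega>" and a: "a \<in> \<Omega>" and f: "cont_diff_on k \<Omega> f" "flat k a f"
  obtains F :: "'N \<times> bool \<Rightarrow> real ^ 'N \<Rightarrow> real"
  where "\<And>p. cont_diff_on k \<Omega> (F p)" and "\<And>x. f x = (\<Sum>p\<in>UNIV. F p x)"
    and "\<And>j s x. (if s then 1 else - 1) * (x - a) $ j < 0 \<Longrightarrow> F (j, s) x = 0"
proof -
  \<comment> \<open>One more than k, so that the q-th power of a positive part is of class
    C^k.\<close>
  define q where "q = Suc k"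
  define P where "P = (\<lambda>p x. max 0 ((if snd p then 1 else - 1) * (x - a) $ fst p) ^ q)"
  define Q where "Q = (\<lambda>x. \<Sum>p\<in>UNIV. P p x)"
  define F where "F = (\<lambda>p x. f x * (P p x * inverse (Q x)))"
  have op': "open (- {a})" by (simp add: open_Compl)
  have P: "cont_diff_on k (- {a}) (P p)" "growth k a (real q) (P p)" for p
  proof -
    have "cont_diff_on k (- {a}) (\<lambda>x. (if snd p then 1 else - 1) * (x - a) $ fst p)"
      unfolding vector_minus_component
      by (intro cont_diff_on_mult cont_diff_on_diff cont_diff_on_const cont_diff_on_nth op')
    then show "cont_diff_on k (- {a}) (P p)"
      unfolding P_def by (rule cont_diff_on_pos_part_power[OF op']) (simp add: q_def)
    show "growth k a (real q) (P p)"
      unfolding P_def by (rule growth_pos_part) (simp add: q_def)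
  qed
  have Q: "cont_diff_on k (- {a}) Q" "growth k a (real q) Q"
    unfolding Q_def using P by (auto intro: cont_diff_on_sum[OF op'] growth_sum)
  \<comment> \<open>Some coordinate of x - a has modulus at least the norm divided by the dimension;
    its part of the right sign alone accounts for this constant.\<close>
  let ?c = "(1 / real CARD('N)) ^ q"
  have lower: "?c * norm (x - a) powr real q \<le> Q x" if "x \<noteq> a" for x
  proof -
    obtain j where j: "norm (x - a) / real CARD('N) \<le> \<bar>(x - a) $ j\<bar>"
    proof (rule ccontr)
      assume "\<not> thesis"
      then have less: "\<bar>(x - a) $ j\<bar> < norm (x - a) / real CARD('N)" for j
        using that by (meson not_le)
      have "norm (x - a) \<le> (\<Sum>j\<in>UNIV. \<bar>(x - a) $ j\<bar>)" by (rule norm_le_l1_cart)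
      also have "\<dots> < (\<Sum>j\<in>(UNIV :: 'N set). norm (x - a) / real CARD('N))"
        using less by (intro sum_strict_mono) auto
      finally show False by simp
    qed
    define p where "p = (j, (x - a) $ j \<ge> 0)"
    have "?c * norm (x - a) powr real q = (norm (x - a) / real CARD('N)) ^ q"
      using that by (simp add: powr_realpow power_divide)
    also have "\<dots> \<le> \<bar>(x - a) $ j\<bar> ^ q"
      using j by (intro power_mono) auto
    also have "\<dots> = P p x" by (simp add: P_def p_def abs_if max_def)
    also have "\<dots> \<le> Q x"
      unfolding Q_def by (rule member_le_sum) (auto simp: P_def)
    finally show ?thesis .
  qed
  have "?c > 0" by simp
  from growth_inverse[OF this lower Q]
  have inv: "cont_diff_on k (- {a}) (\<lambda>x. inverse (Q x))" "growth k a (- real q) (\<lambda>x. inverse (Q x))"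
    by auto
  show thesis
  proof
    show "cont_diff_on k \<Omega> (F p)" for p
      unfolding F_def
    proof (rule flat_times_growth[OF op a f])
      show "cont_diff_on k (- {a}) (\<lambda>x. P p x * inverse (Q x))"
        using P inv by (intro cont_diff_on_mult[OF op'])
      \<comment> \<open>The exponent 0 is just enough: f is k-flat and k derivatives are
        wanted.\<close>
      show "growth k a (real q + - real q) (\<lambda>x. P p x * inverse (Q x))"
        using P inv by (intro growth_mult)
    qed auto
    show "f x = (\<Sum>p\<in>UNIV. F p x)" for x
    proof (cases "x = a")
      case True
      then show ?thesis using flat_zero[OF f(2)] by (simp add: F_def)
    next
      case False
      then have "0 < ?c * norm (x - a) powr real q" by simp
      then have "Q x \<noteq> 0" using lower[OF False] by linarith
      moreover have "(\<Sum>p\<in>UNIV. F p x) = f x * (Q x * inverse (Q x))"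
        unfolding F_def Q_def sum_distrib_left sum_distrib_right ..
      ultimately show ?thesis by simp
    qed
    show "F (j, s) x = 0" if "(if s then 1 else - 1) * (x - a) $ j < 0" for j s x
      using that by (auto simp: F_def P_def q_def max_def)
  qed
qed

section \<open>Local additive operators depend only on the k-jet\<close>

definition local_operator ::
    "nat \<Rightarrow> (real ^ 'N) set \<Rightarrow> ((real ^ 'N \<Rightarrow> real) \<Rightarrow> real ^ 'N \<Rightarrow> real) \<Rightarrow> bool" where
  "local_operator k \<Omega> S \<longleftrightarrow> (\<forall>f\<in>Ck k \<Omega>. \<forall>U. open U \<longrightarrow> U \<subseteq> \<Omega> \<longrightarrow> (\<forall>x\<in>U. f x = 0) \<longrightarrow> (\<forall>x\<in>U. S f x = 0))"

lemma additive_operator_add: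
  "additive_operator k \<Omega> S \<Longrightarrow> f \<in> Ck k \<Omega> \<Longrightarrow> g \<in> Ck k \<Omega> \<Longrightarrow> x \<in> \<Omega> \<Longrightarrow>
   S (\<lambda>y. f y + g y) x = S f x + S g x"
  by (simp add: additive_operator_def)

context
  fixes \<Omega> :: "(real ^ 'N) set" and k :: nat and S
  assumes op: "open \<Omega>" and S: "Ck_operator k \<Omega> S" "additive_operator k \<Omega> S"
begin

lemma Ck_operator_cong:
  "f \<in> Ck k \<Omega> \<Longrightarrow> (\<And>y. y \<in> \<Omega> \<Longrightarrow> f y = g y) \<Longrightarrow> x \<in> \<Omega> \<Longrightarrow> S f x = S g x"
  using S(1) cont_diff_on_cong[OF op, of k f g] unfolding Ck_operator_def Ck_def by blast

lemma Ck_operator_continuous: "f \<in> Ck k \<Omega> \<Longrightarrow> continuous_on \<Omega> (S f)"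
  using S(1) unfolding Ck_operator_def by blast

lemma additive_operator_zero: "x \<in> \<Omega> \<Longrightarrow> S (\<lambda>_. 0) x = 0"
  using additive_operator_add[OF S(2), of "\<lambda>_. 0" "\<lambda>_. 0" x] cont_diff_on_const[OF op]
  by (simp add: Ck_def)

lemma additive_operator_diff:
  assumes "f \<in> Ck k \<Omega>" "g \<in> Ck k \<Omega>" "x \<in> \<Omega>"
  shows "S (\<lambda>y. f y - g y) x = S f x - S g x"
  using additive_operator_add[OF S(2) _ assms(2,3), of "\<lambda>y. f y - g y"] assms
    cont_diff_on_diff[OF op, of k f g] by (simp add: Ck_def)

lemma additive_operator_sum:
  "(\<And>i. i \<in> I \<Longrightarrow> f i \<in> Ck k \<Omega>) \<Longrightarrow> x \<in> \<Omega> \<Longrightarrow> S (\<lambda>y. \<Sum>i\<in>I. f i y) x = (\<Sum>i\<in>I. S (f i) x)"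
proof (induction I rule: infinite_finite_induct)
  case (insert i I)
  then show ?case
    using additive_operator_add[OF S(2), of "f i" "\<lambda>y. \<Sum>i\<in>I. f i y" x] cont_diff_on_sum[OF op, of I k f]
    by (simp add: Ck_def)
qed (auto intro: additive_operator_zero)

text \<open>Each summand of the decomposition vanishes on an open half space whose boundary passes
  through a. By locality its image vanishes on the part of the half space in \<Omega>, and by
  continuity of the image also at a.\<close>

lemma operator_flat_eq_0:
  assumes loc: "local_operator k \<Omega> S" and a: "a \<in> \<Omega>" and f: "f \<in> Ck k \<Omega>" "flat k a f"
  shows "S f a = 0"
proof -
  obtain F :: "'N \<times> bool \<Rightarrow> real ^ 'N \<Rightarrow> real"
    where F: "\<And>p. cont_diff_on k \<Omega> (F p)" "\<And>x. f x = (\<Sum>p\<in>UNIV. F p x)"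
    and vanish: "\<And>j s x. (if s then 1 else - 1) * (x - a) $ j < 0 \<Longrightarrow> F (j, s) x = 0"
    using flat_decomposition[OF op a, of k f] f by (auto simp: Ck_def)
  have "S (F (j, s)) a = 0" for j s
  proof -
    let ?\<sigma> = "if s then 1 else - 1 :: real"
    let ?U = "\<Omega> \<inter> {x. ?\<sigma> * (x - a) $ j < 0}"
    \<comment> \<open>This path leaves a straight into the half space:
      \<open>?\<sigma> * (?x t - a) $ j\<close> equals -t.\<close>
    let ?x = "\<lambda>t. a - (t * ?\<sigma>) *\<^sub>R axis j 1"
    have "open ?U"
      by (intro open_Int op open_Collect_less continuous_intros)
    then have zero: "S (F (j, s)) x = 0" if "x \<in> ?U" for x
      using loc F(1) vanish that unfolding local_operator_def Ck_def by blast
    have lim: "(?x \<longlongrightarrow> a) (at_right 0)"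
      by (auto intro!: tendsto_eq_intros)
    then have "eventually (\<lambda>t. ?x t \<in> \<Omega>) (at_right 0)"
      using op a by (rule topological_tendstoD)
    moreover have "eventually (\<lambda>t::real. t > 0) (at_right 0)"
      by (rule eventually_at_right_less)
    ultimately have "eventually (\<lambda>t. S (F (j, s)) (?x t) = 0) (at_right 0)"
    proof eventually_elim
      case (elim t)
      then show ?case by (intro zero) auto
    qed
    moreover have "isCont (S (F (j, s))) a"
      using Ck_operator_continuous[of "F (j, s)"] F(1) a op
      by (auto simp: Ck_def continuous_on_eq_continuous_at)
    then have "((\<lambda>t. S (F (j, s)) (?x t)) \<longlongrightarrow> S (F (j, s)) a) (at_right 0)"
      using lim by (rule isCont_tendsto_compose)
    ultimately have "((\<lambda>t::real. 0::real) \<longlongrightarrow> S (F (j, s)) a) (at_right 0)"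
      by (rule Lim_transform_eventually[rotated])
    then show ?thesis
      by (simp add: tendsto_const_iff)
  qed
  then have "S (F p) a = 0" for p by (cases p) simp
  then have "S (\<lambda>x. \<Sum>p\<in>UNIV. F p x) a = 0"
    using F(1) a by (subst additive_operator_sum) (auto simp: Ck_def)
  moreover have "f = (\<lambda>x. \<Sum>p\<in>UNIV. F p x)" using F(2) by blast
  ultimately show ?thesis by simp
qed

lemma operator_eq_taylor:
  assumes "local_operator k \<Omega> S" "a \<in> \<Omega>" "f \<in> Ck k \<Omega>"
  shows "S f a = S (taylor_poly k a f) a"
proof -
  have p: "taylor_poly k a f \<in> Ck k \<Omega>"
    using cont_diff_on_polynomial[OF op taylor_poly_polynomial] by (simp add: Ck_def)
  have "S (\<lambda>x. f x - taylor_poly k a f x) a = 0"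
    using assms p flat_taylor_remainder[OF op, of a k f] cont_diff_on_diff[OF op, of k f "taylor_poly k a f"]
    by (intro operator_flat_eq_0) (auto simp: Ck_def)
  then show ?thesis
    using additive_operator_diff[OF assms(3) p assms(2)] by simp
qed

end

subsection \<open>Constants are annihilated\<close>

lemma DERIV_Re_entire:
  assumes "g holomorphic_on UNIV"
  shows "((\<lambda>t. Re (g (of_real t))) has_real_derivative Re (deriv g (of_real t))) (at t)"
proof -
  have "(g has_field_derivative deriv g (of_real t)) (at (of_real t))"
    using assms by (simp add: holomorphic_derivI)
  then have "((\<lambda>t. g (of_real t)) has_vector_derivative deriv g (of_real t)) (at t)"
    by (rule has_vector_derivative_real_field)
  then have "((\<lambda>t. Re (g (of_real t))) has_vector_derivative Re (deriv g (of_real t))) (at t)"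
    by (rule bounded_linear.has_vector_derivative[OF bounded_linear_Re])
  then show ?thesis by (simp add: has_real_derivative_iff_has_vector_derivative)
qed

text \<open>Derivatives of an entire function are entire, so one induction gives all orders. This
  replaces termwise differentiation of a real series.\<close>

lemma cont_diff_on_Re_entire:
  fixes \<Omega> :: "(real ^ 'N) set"
  assumes op: "open \<Omega>"
  shows "g holomorphic_on UNIV \<Longrightarrow> cont_diff_on k \<Omega> (\<lambda>x. Re (g (of_real (x $ i))))"
proof (induction k arbitrary: g)
  case 0
  have "continuous_on UNIV g" using 0 by (rule holomorphic_on_imp_continuous_on)
  then have "continuous_on \<Omega> (\<lambda>x. g (of_real (x $ i)))"
    by (rule continuous_on_compose2) (auto intro!: continuous_intros)
  then show ?case by (auto intro: continuous_intros)
next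
  case (Suc k)
  have D: "dird v (\<lambda>x. Re (g (of_real (x $ i)))) x = Re (deriv g (of_real (x $ i))) * v $ i"
    and diff: "(\<lambda>x. Re (g (of_real (x $ i)))) differentiable (at x)" for v x :: "real ^ 'N"
    using dird_DERIV[OF nth_differentiable DERIV_Re_entire[OF Suc.prems]] by auto
  have "deriv g holomorphic_on UNIV"
    using Suc.prems by (intro holomorphic_deriv) auto
  then have D': "cont_diff_on k \<Omega> (\<lambda>x. Re (deriv g (of_real (x $ i))) * v $ i)" for v
    by (intro cont_diff_on_mult cont_diff_on_const op Suc.IH)
  have "cont_diff_on k \<Omega> (dird v (\<lambda>x. Re (g (of_real (x $ i)))))" for v
    by (rule cont_diff_on_cong[OF op D'[of v]]) (simp add: D)
  with diff show ?case by (simp add: cont_diff_on_Suc)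
qed

text \<open>The j-th term has at most 3 j bounded factors, so on every bounded set it is dominated
  by M^j / j!, and the complexified series is entire. The index sets \<open>L j\<close> may be
  smaller than \<open>{..<j}\<close> so that the tail with one node divided out is covered
  too.\<close>

lemma cont_diff_on_newton_series:
  fixes \<Omega> :: "(real ^ 'N) set" and r \<xi> :: "nat \<Rightarrow> real"
  assumes op: "open \<Omega>" and r: "\<And>j. \<bar>r j\<bar> \<le> 1 / fact j" and \<xi>: "\<And>l. \<bar>\<xi> l\<bar> \<le> R"
    and L: "\<And>j. L j \<subseteq> {..<j}"
  shows "cont_diff_on k \<Omega> (\<lambda>x. \<Sum>j. r j * (\<Prod>l\<in>L j. (x $ i - \<xi> l) ^ 3))"
    and "summable (\<lambda>j. r j * (\<Prod>l\<in>L j. (t - \<xi> l) ^ 3))"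
proof -
  define w where "w = (\<lambda>j z. complex_of_real (r j) * (\<Prod>l\<in>L j. (z - complex_of_real (\<xi> l)) ^ 3))"
  define g where "g = (\<lambda>z. \<Sum>j. w j z)"
  have R: "R \<ge> 0" using \<xi>[of 0] by linarith
  \<comment> \<open>The summand 1 makes the base at least 1, so that a product over fewer than j
    nodes obeys the same bound.\<close>
  have bound: "norm (w j z) \<le> inverse (fact j) * ((1 + \<rho> + R) ^ 3) ^ j" if "norm z \<le> \<rho>" for j z \<rho>
  proof -
    have "0 \<le> \<rho>" using that norm_ge_zero order_trans by blast
    have "norm (\<Prod>l\<in>L j. (z - of_real (\<xi> l)) ^ 3) \<le> (\<Prod>l\<in>L j. (1 + \<rho> + R) ^ 3)"
      unfolding prod_norm[symmetric] norm_power
    proof (intro prod_mono conjI power_mono)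
      fix l show "norm (z - of_real (\<xi> l)) \<le> 1 + \<rho> + R"
        using norm_triangle_ineq4[of z "of_real (\<xi> l)"] that \<xi>[of l] by simp
    qed auto
    also have "\<dots> = ((1 + \<rho> + R) ^ 3) ^ card (L j)" by simp
    also have "\<dots> \<le> ((1 + \<rho> + R) ^ 3) ^ j"
      using card_mono[OF _ L[of j]] R \<open>0 \<le> \<rho>\<close> by (intro power_increasing one_le_power) auto
    finally show ?thesis
      unfolding w_def norm_mult using r[of j]
      by (intro mult_mono) (auto simp: divide_inverse)
  qed
  have sm: "summable (\<lambda>j. inverse (fact j) * ((1 + \<rho> + R) ^ 3) ^ j)" for \<rho> :: real
    using summable_exp by blast
  have hol: "g holomorphic_on UNIV"
  proof (rule holomorphic_uniform_sequence[where f = "\<lambda>n z. \<Sum>j<n. w j z"])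
    show "(\<lambda>z. \<Sum>j<n. w j z) holomorphic_on UNIV" for n
      unfolding w_def by (intro holomorphic_intros)
    fix x :: complex
    have "uniform_limit (cball x 1) (\<lambda>n z. \<Sum>j<n. w j z) g sequentially"
      unfolding g_def
    proof (rule Weierstrass_m_test[OF _ sm])
      fix j z assume "z \<in> cball x 1"
      then have "norm z \<le> norm x + 1"
        using norm_triangle_sub[of z x] by (simp add: dist_norm norm_minus_commute)
      then show "norm (w j z) \<le> inverse (fact j) * ((1 + (norm x + 1) + R) ^ 3) ^ j" by (rule bound)
    qed
    then show "\<exists>d>0. cball x d \<subseteq> UNIV \<and> uniform_limit (cball x d) (\<lambda>n z. \<Sum>j<n. w j z) g sequentially"
      by (intro exI[of _ 1]) auto
  qed auto
  have real: "w j (of_real t) = of_real (r j * (\<Prod>l\<in>L j. (t - \<xi> l) ^ 3))" for j t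
    by (simp add: w_def)
  have sm': "summable (\<lambda>j. r j * (\<Prod>l\<in>L j. (t - \<xi> l) ^ 3))" for t
  proof (rule summable_comparison_test[OF _ sm])
    show "\<exists>N. \<forall>n\<ge>N. norm (r n * (\<Prod>l\<in>L n. (t - \<xi> l) ^ 3)) \<le> inverse (fact n) * ((1 + \<bar>t\<bar> + R) ^ 3) ^ n"
      using bound[of "of_real t" "\<bar>t\<bar>"] unfolding real norm_of_real by auto
  qed
  then show "summable (\<lambda>j. r j * (\<Prod>l\<in>L j. (t - \<xi> l) ^ 3))" .
  have "Re (g (of_real t)) = (\<Sum>j. r j * (\<Prod>l\<in>L j. (t - \<xi> l) ^ 3))" for t
    unfolding g_def real suminf_of_real[OF sm', symmetric] by (rule Re_complex_of_real)
  with cont_diff_on_Re_entire[OF op hol, of k i]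
  show "cont_diff_on k \<Omega> (\<lambda>x. \<Sum>j. r j * (\<Prod>l\<in>L j. (x $ i - \<xi> l) ^ 3))" by simp
qed

section \<open>Derivations of the field of real numbers\<close>

lemma real_derivation_Rats:
  fixes \<sigma> :: "real \<Rightarrow> real"
  assumes add: "\<And>a b. \<sigma> (a + b) = \<sigma> a + \<sigma> b" and mult: "\<And>a b. \<sigma> (a * b) = a * \<sigma> b + b * \<sigma> a"
    and q: "q \<in> \<rat>"
  shows "\<sigma> q = 0"
proof -
  have 0: "\<sigma> 0 = 0" using add[of 0 0] by simp
  have 1: "\<sigma> 1 = 0" using mult[of 1 1] by simp
  have nat: "\<sigma> (real n) = 0" for n
    by (induction n) (auto simp: 0 1 add)
  have minus: "\<sigma> (- a) = - \<sigma> a" for a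
    using add[of a "- a"] 0 by simp
  have int: "\<sigma> (of_int z) = 0" for z
    by (cases z rule: int_cases2) (auto simp: nat minus)
  obtain a b where ab: "q = of_int a / of_int b" "b \<noteq> (0::int)" using q by (auto elim: Rats_cases')
  have "\<sigma> (q * of_int b) = q * \<sigma> (of_int b) + of_int b * \<sigma> q" by (rule mult)
  with ab int[of a] int[of b] show ?thesis by simp
qed

text \<open>A derivation vanishes on the rationals, so subtracting from m s a rational close to it
  keeps the value m \<sigma>(s), as large as desired, while the argument becomes as small as
  desired.\<close>

lemma real_derivation_unbounded:
  fixes \<sigma> :: "real \<Rightarrow> real"
  assumes add: "\<And>a b. \<sigma> (a + b) = \<sigma> a + \<sigma> b" and mult: "\<And>a b. \<sigma> (a * b) = a * \<sigma> b + b * \<sigma> a"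
    and s: "\<sigma> s \<noteq> 0" and \<epsilon>: "\<epsilon> > 0"
  shows "\<exists>r. \<bar>r\<bar> \<le> \<epsilon> \<and> \<bar>\<sigma> r\<bar> \<ge> K"
proof -
  obtain m :: nat where m: "K / \<bar>\<sigma> s\<bar> \<le> real m" using real_arch_simple by blast
  obtain q where q: "q \<in> \<rat>" "real m * s - \<epsilon> < q" "q < real m * s"
    using Rats_dense_in_real[of "real m * s - \<epsilon>" "real m * s"] \<epsilon> by auto
  have "\<sigma> q = 0" "\<sigma> (real m) = 0"
    using real_derivation_Rats[of \<sigma>, OF add mult] q(1) by auto
  moreover have "\<sigma> (real m * s) = \<sigma> (real m * s - q) + \<sigma> q"
    using add[of "real m * s - q" q] by simp
  ultimately have "\<sigma> (real m * s - q) = real m * \<sigma> s" by (simp add: mult)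
  then have "\<bar>\<sigma> (real m * s - q)\<bar> \<ge> K" using m s by (simp add: abs_mult field_simps)
  with q show ?thesis by (intro exI[of _ "real m * s - q"]) auto
qed

text \<open>
  Gliding hump: if \<open>S\<close> did not annihilate the constants, a Newton series in one coordinate, with
  triple nodes converging to a point and tiny coefficients chosen one after the other, would have
  an unbounded image. At each node the tail of the series does not contribute, because it is
  divisible by the cube of a function vanishing there.
\<close>

lemma operator_constant_eq_0:
  fixes \<Omega> :: "(real ^ 'N) set"
  assumes op: "open \<Omega>" and S: "Ck_operator k \<Omega> S" "additive_operator k \<Omega> S"
    and scale: "\<And>r \<phi> x. \<phi> \<in> Ck k \<Omega> \<Longrightarrow> x \<in> \<Omega> \<Longrightarrow>
      S (\<lambda>y. r * \<phi> y) x = r * S \<phi> x + \<phi> x * S (\<lambda>_. r) x"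
    and cube: "\<And>g h x. g \<in> Ck k \<Omega> \<Longrightarrow> h \<in> Ck k \<Omega> \<Longrightarrow> x \<in> \<Omega> \<Longrightarrow> g x = 0 \<Longrightarrow>
      S (\<lambda>y. g y ^ 3 * h y) x = 0"
    and x0: "x\<^sub>0 \<in> \<Omega>"
  shows "S (\<lambda>_. s) x\<^sub>0 = 0"
proof (rule ccontr)
  assume ne: "S (\<lambda>_. s) x\<^sub>0 \<noteq> 0"
  have C: "(\<lambda>_. c) \<in> Ck k \<Omega>" for c by (simp add: Ck_def cont_diff_on_const op)
  have cont: "isCont (S f) x\<^sub>0" if "f \<in> Ck k \<Omega>" for f
    using Ck_operator_continuous[OF op S that] op x0 by (simp add: continuous_on_eq_continuous_at)
  obtain d1 where d1: "d1 > 0" "ball x\<^sub>0 d1 \<subseteq> \<Omega>" using op x0 open_contains_ball by blast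
  obtain d2 where d2: "d2 > 0" "\<And>y. dist y x\<^sub>0 < d2 \<Longrightarrow> S (\<lambda>_. s) y \<noteq> 0"
    using continuous_at_avoid[OF cont[OF C] ne] by (metis dist_commute)
  define \<delta> where "\<delta> = min d1 d2"
  have \<delta>: "\<delta> > 0" "\<And>y. dist y x\<^sub>0 < \<delta> \<Longrightarrow> y \<in> \<Omega> \<and> S (\<lambda>_. s) y \<noteq> 0"
    using d1 d2 by (auto simp: \<delta>_def dist_commute)
  obtain i :: 'N where True by blast
  \<comment> \<open>The 2 keeps even the first node at distance below \<delta>. The nodes differ
    only in coordinate i, so a function of this coordinate separates them.\<close>
  define p where "p = (\<lambda>j::nat. x\<^sub>0 + (\<delta> / (real j + 2)) *\<^sub>R axis i 1)"
  define \<xi> where "\<xi> = (\<lambda>j. p j $ i)"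
  have \<xi>_eq: "\<xi> j = x\<^sub>0 $ i + \<delta> / (real j + 2)" for j by (simp add: \<xi>_def p_def)
  have dist_p: "dist (p j) x\<^sub>0 = \<delta> / (real j + 2)" for j
    using \<delta>(1) by (simp add: p_def dist_norm)
  have p: "p j \<in> \<Omega>" "S (\<lambda>_. s) (p j) \<noteq> 0" for j
    using \<delta>(2)[of "p j"] \<delta>(1) by (auto simp: dist_p divide_simps)
  have \<xi>_inj: "\<xi> l \<noteq> \<xi> j" if "l < j" for l j
    using that \<delta>(1) by (simp add: \<xi>_eq)
  have \<xi>_bd: "\<bar>\<xi> l\<bar> \<le> \<bar>x\<^sub>0 $ i\<bar> + \<delta>" for l
  proof -
    have "\<delta> / (real l + 2) \<le> \<delta>" "\<delta> / (real l + 2) \<ge> 0" using \<delta>(1) by (auto simp: divide_simps)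
    then show ?thesis unfolding \<xi>_eq by linarith
  qed
  define \<phi> where "\<phi> = (\<lambda>j x. \<Prod>l<j. (x $ i - \<xi> l) ^ 3)"
  have \<phi>: "\<phi> j \<in> Ck k \<Omega>" for j
    unfolding Ck_def \<phi>_def mem_Collect_eq
    by (intro cont_diff_on_prod cont_diff_on_power cont_diff_on_diff cont_diff_on_nth cont_diff_on_const op)
  have r\<phi>: "(\<lambda>x. r * \<phi> j x) \<in> Ck k \<Omega>" for r j
    using \<phi>[of j] by (simp add: Ck_def cont_diff_on_mult cont_diff_on_const op)
  have \<phi>_ne: "\<phi> j (p j) \<noteq> 0" for j
  proof -
    have "p j $ i = \<xi> j" by (simp add: \<xi>_def)
    then show ?thesis unfolding \<phi>_def using \<xi>_inj[of _ j] by fastforce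
  qed
  have step: "\<exists>r. \<bar>r\<bar> \<le> 1 / fact n \<and> \<bar>S (\<lambda>x. h x + r * \<phi> n x) (p n)\<bar> \<ge> real n"
    if h: "h \<in> Ck k \<Omega>" for h n
  proof -
    define \<sigma> where "\<sigma> = (\<lambda>r. S (\<lambda>_. r) (p n))"
    have add: "\<sigma> (a + b) = \<sigma> a + \<sigma> b" for a b
      unfolding \<sigma>_def by (rule additive_operator_add[OF S(2) C C p(1)])
    have mult: "\<sigma> (a * b) = a * \<sigma> b + b * \<sigma> a" for a b
      unfolding \<sigma>_def by (rule scale[OF C p(1)])
    \<comment> \<open>Large enough that the term \<open>\<phi> n (p n) * \<sigma> r\<close>
      outweighs n, the value of the part already chosen and \<open>r * S (\<phi> n) (p n)\<close>,
      the last being controlled by \<open>\<bar>r\<bar> \<le> 1\<close>.\<close>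
    let ?K = "(real n + \<bar>S h (p n)\<bar> + \<bar>S (\<phi> n) (p n)\<bar>) / \<bar>\<phi> n (p n)\<bar>"
    have "0 < 1 / (fact n :: real)" by simp
    moreover have "\<sigma> s \<noteq> 0" using p(2)[of n] by (simp add: \<sigma>_def)
    ultimately obtain r where r: "\<bar>r\<bar> \<le> 1 / fact n" "\<bar>\<sigma> r\<bar> \<ge> ?K"
      using real_derivation_unbounded[of \<sigma>, OF add mult] by blast
    have "1 / fact n \<le> (1::real)" by (simp add: divide_simps)
    then have "\<bar>r\<bar> \<le> 1" using r(1) by linarith
    then have "\<bar>r * S (\<phi> n) (p n)\<bar> \<le> \<bar>S (\<phi> n) (p n)\<bar>"
      by (simp add: abs_mult mult_left_le_one_le)
    moreover have "\<bar>\<phi> n (p n) * \<sigma> r\<bar> \<ge> real n + \<bar>S h (p n)\<bar> + \<bar>S (\<phi> n) (p n)\<bar>"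
      using r(2) \<phi>_ne[of n] by (simp add: abs_mult field_simps)
    moreover have "S (\<lambda>x. h x + r * \<phi> n x) (p n) = S h (p n) + (r * S (\<phi> n) (p n) + \<phi> n (p n) * \<sigma> r)"
      using additive_operator_add[OF S(2) h r\<phi> p(1)] scale[OF \<phi> p(1)] by (simp add: \<sigma>_def)
    ultimately have "\<bar>S (\<lambda>x. h x + r * \<phi> n x) (p n)\<bar> \<ge> real n" by linarith
    with r(1) show ?thesis by blast
  qed
  \<comment> \<open>A state is a pair of the partial sum and the coefficient added last; in the
    initial state the coefficient is a dummy.\<close>
  have "\<exists>f. \<forall>n. (fst (f n) \<in> Ck k \<Omega> \<and> (n = 0 \<longrightarrow> fst (f n) = (\<lambda>_. 0))) \<and>
      (fst (f (Suc n)) = (\<lambda>x. fst (f n) x + snd (f (Suc n)) * \<phi> n x) \<and>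
       \<bar>snd (f (Suc n))\<bar> \<le> 1 / fact n \<and> \<bar>S (fst (f (Suc n))) (p n)\<bar> \<ge> real n)"
  proof (rule dependent_nat_choice)
    show "\<exists>y::(real ^ 'N \<Rightarrow> real) \<times> real. fst y \<in> Ck k \<Omega> \<and> (0 = (0::nat) \<longrightarrow> fst y = (\<lambda>_. 0))"
      using C by (intro exI[of _ "((\<lambda>_. 0), 0)"]) simp
    fix x :: "(real ^ 'N \<Rightarrow> real) \<times> real" and n :: nat
    assume x: "fst x \<in> Ck k \<Omega> \<and> (n = 0 \<longrightarrow> fst x = (\<lambda>_. 0))"
    obtain r where r: "\<bar>r\<bar> \<le> 1 / fact n" "\<bar>S (\<lambda>y. fst x y + r * \<phi> n y) (p n)\<bar> \<ge> real n"
      using step[of "fst x" n] x by blast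
    have "(\<lambda>y. fst x y + r * \<phi> n y) \<in> Ck k \<Omega>"
      using x r\<phi>[of r n] by (simp add: Ck_def cont_diff_on_add op)
    with r show "\<exists>y. (fst y \<in> Ck k \<Omega> \<and> (Suc n = 0 \<longrightarrow> fst y = (\<lambda>_. 0))) \<and>
        (fst y = (\<lambda>z. fst x z + snd y * \<phi> n z) \<and> \<bar>snd y\<bar> \<le> 1 / fact n \<and> \<bar>S (fst y) (p n)\<bar> \<ge> real n)"
      by (intro exI[of _ "((\<lambda>y. fst x y + r * \<phi> n y), r)"]) simp
  qed
  then obtain f :: "nat \<Rightarrow> (real ^ 'N \<Rightarrow> real) \<times> real" where f0: "fst (f 0) = (\<lambda>_. 0)"
    and fSuc: "\<And>n. fst (f (Suc n)) = (\<lambda>x. fst (f n) x + snd (f (Suc n)) * \<phi> n x)"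
    and f_small: "\<And>n. \<bar>snd (f (Suc n))\<bar> \<le> 1 / fact n"
    and f_large: "\<And>n. \<bar>S (fst (f (Suc n))) (p n)\<bar> \<ge> real n"
    and f_Ck: "\<And>n. fst (f n) \<in> Ck k \<Omega>"
    by blast
  define r where "r = (\<lambda>n. snd (f (Suc n)))"
  have r: "\<bar>r j\<bar> \<le> 1 / fact j" for j using f_small by (simp add: r_def)
  have partial: "fst (f n) = (\<lambda>x. \<Sum>j<n. r j * \<phi> j x)" for n
  proof (induction n)
    case (Suc n)
    show ?case unfolding fSuc[of n] Suc by (simp add: r_def)
  qed (simp add: f0)
  define F where "F = (\<lambda>x. \<Sum>j. r j * \<phi> j x)"
  have F: "F \<in> Ck k \<Omega>"
    unfolding F_def \<phi>_def Ck_def using cont_diff_on_newton_series(1)[OF op r \<xi>_bd, of "\<lambda>j. {..<j}"] by simp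
  have F_large: "\<bar>S F (p n)\<bar> \<ge> real n" for n
  proof -
    \<comment> \<open>The terms up to n do not contain node n and are removed by \<open>r'\<close>;
      in the others \<open>w\<close> omits the cube belonging to node n, which can then be pulled
      out of the whole tail.\<close>
    define r' where "r' = (\<lambda>j. if j \<le> n then 0 else r j)"
    define w where "w = (\<lambda>j x. \<Prod>l\<in>{..<j} - {n}. (x $ i - \<xi> l) ^ 3)"
    define h where "h = (\<lambda>x. \<Sum>j. r' j * w j x)"
    have r': "\<bar>r' j\<bar> \<le> 1 / fact j" for j using r[of j] by (simp add: r'_def)
    have L: "{..<j} - {n} \<subseteq> {..<j}" for j by auto
    have h: "h \<in> Ck k \<Omega>"
      unfolding h_def w_def Ck_def using cont_diff_on_newton_series(1)[OF op r' \<xi>_bd L] by simp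
    have F_split: "F x = fst (f (Suc n)) x + (x $ i - \<xi> n) ^ 3 * h x" for x
    proof -
      have 1: "r j * \<phi> j x = (if j \<in> {..<Suc n} then r j * \<phi> j x else 0) + (x $ i - \<xi> n) ^ 3 * (r' j * w j x)" for j
      proof (cases "j \<le> n")
        case False
        then have "\<phi> j x = (x $ i - \<xi> n) ^ 3 * w j x"
          unfolding \<phi>_def w_def by (subst prod.remove[of _ n]) auto
        with False show ?thesis by (simp add: r'_def)
      qed (simp add: r'_def)
      have s: "summable (\<lambda>j. r' j * w j x)"
        unfolding w_def by (rule cont_diff_on_newton_series(2)[OF op r' \<xi>_bd L])
      have "(\<lambda>j. if j \<in> {..<Suc n} then r j * \<phi> j x else 0) sums (\<Sum>j<Suc n. r j * \<phi> j x)"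
        by (rule sums_If_finite_set) simp
      moreover have "(\<lambda>j. (x $ i - \<xi> n) ^ 3 * (r' j * w j x)) sums ((x $ i - \<xi> n) ^ 3 * h x)"
        unfolding h_def by (intro sums_mult summable_sums s)
      ultimately have "(\<lambda>j. r j * \<phi> j x) sums ((\<Sum>j<Suc n. r j * \<phi> j x) + (x $ i - \<xi> n) ^ 3 * h x)"
        using sums_add 1 by (metis (no_types, lifting) sums_cong)
      then show ?thesis
        unfolding F_def partial by (rule sums_unique[symmetric])
    qed
    have g: "(\<lambda>x. x $ i - \<xi> n) \<in> Ck k \<Omega>"
      by (simp add: Ck_def cont_diff_on_diff cont_diff_on_nth cont_diff_on_const op)
    have gh: "(\<lambda>x. (x $ i - \<xi> n) ^ 3 * h x) \<in> Ck k \<Omega>"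
      using g h by (simp add: Ck_def cont_diff_on_mult cont_diff_on_power op)
    have "S (\<lambda>x. (x $ i - \<xi> n) ^ 3 * h x) (p n) = 0"
      by (rule cube[OF g h p(1)]) (simp add: \<xi>_def)
    moreover have "F = (\<lambda>x. fst (f (Suc n)) x + (x $ i - \<xi> n) ^ 3 * h x)"
      using F_split by (rule ext)
    ultimately have "S F (p n) = S (fst (f (Suc n))) (p n)"
      using additive_operator_add[OF S(2) f_Ck[of "Suc n"] gh p(1)] by simp
    with f_large[of n] show ?thesis by simp
  qed
  have "(\<lambda>n. p n) \<longlonglongrightarrow> x\<^sub>0"
  proof -
    have "(\<lambda>n. \<delta> / (real n + 2)) \<longlonglongrightarrow> 0" by real_asymp
    then show ?thesis by (simp add: tendsto_dist_iff[of p] dist_p)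
  qed
  \<comment> \<open>Continuity of \<open>S F\<close> at \<open>x\<^sub>0\<close> bounds its values
    along the nodes, against \<open>F_large\<close>.\<close>
  then have "(\<lambda>n. S F (p n)) \<longlonglongrightarrow> S F x\<^sub>0"
    by (rule isCont_tendsto_compose[OF cont[OF F]])
  then have "Bseq (\<lambda>n. S F (p n))"
    using convergentI convergent_imp_Bseq by blast
  then obtain B where B: "\<And>n. \<bar>S F (p n)\<bar> \<le> B" unfolding Bseq_def by auto
  obtain n where "B < real n" using reals_Archimedean2 by blast
  with B[of n] F_large[of n] show False by linarith
qed

subsection \<open>From the power identity to Leibniz rules\<close>

text \<open>Evaluation at natural m must suffice, as an additive operator need not be homogeneous
  over the reals; infinitely many arguments determine a polynomial. The right side starts at degree
  1, hence the shift of the index.\<close>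

lemma polyfun_nat_coeff:
  fixes \<alpha> \<beta> :: "nat \<Rightarrow> real"
  assumes eq: "\<And>m::nat. (\<Sum>j\<le>n. \<alpha> j * real m ^ j) = (\<Sum>j<n. \<beta> j * real m ^ Suc j)" and i: "i < n"
  shows "\<alpha> (Suc i) = \<beta> i"
proof (rule ccontr)
  assume ne: "\<alpha> (Suc i) \<noteq> \<beta> i"
  define \<gamma> where "\<gamma> = (\<lambda>j. \<alpha> j - (case j of 0 \<Rightarrow> 0 | Suc i \<Rightarrow> \<beta> i))"
  have "(\<Sum>j\<le>n. \<gamma> j * real m ^ j) = 0" for m
  proof -
    have "(\<Sum>j<n. \<beta> j * real m ^ Suc j) = (\<Sum>j\<le>n. (case j of 0 \<Rightarrow> 0 | Suc i \<Rightarrow> \<beta> i) * real m ^ j)"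
      by (simp add: sum.atMost_shift)
    then show ?thesis
      using eq[of m] by (simp add: \<gamma>_def left_diff_distrib sum_subtractf)
  qed
  then have "range real \<subseteq> {x. (\<Sum>j\<le>n. \<gamma> j * x ^ j) = 0}" by auto
  moreover have "infinite (range real)" by (intro range_inj_infinite inj_of_nat)
  ultimately have "infinite {x. (\<Sum>j\<le>n. \<gamma> j * x ^ j) = 0}" using finite_subset by blast
  moreover have "\<gamma> (Suc i) \<noteq> 0" "Suc i \<le> n" using ne i by (auto simp: \<gamma>_def)
  ultimately show False using polyfun_finite_roots[of \<gamma> n] by blast
qed

lemma independent_pairD:
  fixes a b c d :: real
  assumes ind: "independent {(a, b), (c, d)}" and ne: "(a, b) \<noteq> (c, d)"
  shows "a * d \<noteq> b * c"
proof
  assume eq: "a * d = b * c"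
  have "(a, b) \<noteq> 0" using ind dependent_zero[of "{(a, b), (c, d)}"] by auto
  then have "\<exists>t. (c, d) = t *\<^sub>R (a, b)"
    using eq by (cases "a = 0") (auto simp: zero_prod_def field_simps intro: exI[of _ "d / b"] exI[of _ "c / a"])
  then have "(c, d) \<in> span {(a, b)}" by (auto simp: span_singleton)
  moreover have "{(a, b), (c, d)} - {(c, d)} = {(a, b)}" using ne by auto
  ultimately show False using ind unfolding dependent_def by (metis insertI1 insert_commute)
qed

lemma non_degenerateD:
  assumes nd: "non_degenerate k \<Omega> A" and U: "open U" "U \<subseteq> \<Omega>" "x \<in> U"
  obtains g\<^sub>1 g\<^sub>2 where "g\<^sub>1 \<in> Ck k \<Omega>" "g\<^sub>2 \<in> Ck k \<Omega>" "support_in \<Omega> g\<^sub>1 \<subseteq> U" "support_in \<Omega> g\<^sub>2 \<subseteq> U"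
    "g\<^sub>1 x * A g\<^sub>2 x \<noteq> A g\<^sub>1 x * g\<^sub>2 x"
proof -
  have "U \<noteq> {} \<and> open U \<and> U \<subseteq> \<Omega>" using U by blast
  from nd[unfolded non_degenerate_def, rule_format, OF this U(3)]
  show thesis
    by (elim bexE conjE) (rule that, assumption+, erule independent_pairD, assumption)
qed

text \<open>Rationals are fixed, and nonnegative reals are squares, so the map is monotone; a
  monotone map that fixes the rationals is the identity.\<close>

lemma real_ring_hom_id:
  fixes \<mu> :: "real \<Rightarrow> real"
  assumes add: "\<And>a b. \<mu> (a + b) = \<mu> a + \<mu> b" and mult: "\<And>a b. \<mu> (a * b) = \<mu> a * \<mu> b"
    and one: "\<mu> 1 = 1"
  shows "\<mu> r = r"
proof -
  have 0: "\<mu> 0 = 0" using add[of 0 0] by simp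
  have nat: "\<mu> (real n) = real n" for n
    by (induction n) (auto simp: 0 one add)
  have diff: "\<mu> (a - b) = \<mu> a - \<mu> b" for a b
    using add[of "a - b" b] by simp
  have minus: "\<mu> (- a) = - \<mu> a" for a
    using diff[of 0 a] 0 by simp
  have int: "\<mu> (of_int z) = of_int z" for z
    by (cases z rule: int_cases2) (auto simp: nat minus)
  have rat: "\<mu> q = q" if q: "q \<in> \<rat>" for q
  proof -
    obtain a b where ab: "q = of_int a / of_int b" "b \<noteq> (0::int)" using q by (auto elim: Rats_cases')
    have "\<mu> (q * of_int b) = \<mu> q * \<mu> (of_int b)" by (rule mult)
    with ab int[of a] int[of b] show ?thesis by (simp add: field_simps)
  qed
  have mono: "\<mu> a \<le> \<mu> b" if "a \<le> b" for a b
  proof -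
    have "\<mu> (b - a) = \<mu> (sqrt (b - a)) * \<mu> (sqrt (b - a))" using that by (simp flip: mult)
    then have "\<mu> (b - a) \<ge> 0" by simp
    then show ?thesis by (simp add: diff)
  qed
  show ?thesis
  proof (cases "\<mu> r" r rule: linorder_cases)
    case less
    then obtain q where "q \<in> \<rat>" "\<mu> r < q" "q < r" using Rats_dense_in_real by blast
    then show ?thesis using mono[of q r] rat[of q] by simp
  next
    case greater
    then obtain q where "q \<in> \<rat>" "r < q" "q < \<mu> r" using Rats_dense_in_real by blast
    then show ?thesis using mono[of r q] rat[of q] by simp
  qed
qed

context
  fixes \<Omega> :: "(real ^ 'N) set" and k :: nat
  assumes op: "open \<Omega>"
begin

lemma Ck_const: "(\<lambda>_. c) \<in> Ck k \<Omega>" by (simp add: Ck_def cont_diff_on_const op)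
lemma Ck_nth: "(\<lambda>x. x $ i) \<in> Ck k \<Omega>" by (simp add: Ck_def cont_diff_on_nth op)
lemma Ck_add: "f \<in> Ck k \<Omega> \<Longrightarrow> g \<in> Ck k \<Omega> \<Longrightarrow> (\<lambda>x. f x + g x) \<in> Ck k \<Omega>"
  by (simp add: Ck_def cont_diff_on_add op)
lemma Ck_diff: "f \<in> Ck k \<Omega> \<Longrightarrow> g \<in> Ck k \<Omega> \<Longrightarrow> (\<lambda>x. f x - g x) \<in> Ck k \<Omega>"
  by (simp add: Ck_def cont_diff_on_diff op)
lemma Ck_mult: "f \<in> Ck k \<Omega> \<Longrightarrow> g \<in> Ck k \<Omega> \<Longrightarrow> (\<lambda>x. f x * g x) \<in> Ck k \<Omega>"
  by (simp add: Ck_def cont_diff_on_mult op)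
lemma Ck_power: "f \<in> Ck k \<Omega> \<Longrightarrow> (\<lambda>x. f x ^ n) \<in> Ck k \<Omega>"
  by (simp add: Ck_def cont_diff_on_power op)
lemma Ck_sum: "(\<And>i. i \<in> I \<Longrightarrow> f i \<in> Ck k \<Omega>) \<Longrightarrow> (\<lambda>x. \<Sum>i\<in>I. f i x) \<in> Ck k \<Omega>"
  by (simp add: Ck_def cont_diff_on_sum op)

lemmas Ck_intros = Ck_const Ck_nth Ck_add Ck_diff Ck_mult Ck_power Ck_sum

text \<open>A sufficiently high power of the positive part of 1 - |y - x|^2 / r^2 is already of
  class C^k.\<close>

lemma bump_function:
  assumes "open U" "x \<in> U"
  obtains \<phi> where "\<phi> \<in> Ck k \<Omega>" "\<phi> x = 1" "\<And>y. y \<notin> U \<Longrightarrow> \<phi> y = 0"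
proof -
  obtain r where r: "r > 0" "ball x r \<subseteq> U" using assms open_contains_ball by blast
  define \<phi> where "\<phi> = (\<lambda>y. max 0 (1 - (\<Sum>i\<in>UNIV. (y $ i - x $ i) ^ 2) * (1 / r\<^sup>2)) ^ Suc k)"
  have "(\<lambda>y. 1 - (\<Sum>i\<in>UNIV. (y $ i - x $ i) ^ 2) * (1 / r\<^sup>2)) \<in> Ck k \<Omega>"
    by (intro Ck_intros)
  then have "\<phi> \<in> Ck k \<Omega>"
    unfolding \<phi>_def Ck_def by (auto intro!: cont_diff_on_pos_part_power[OF op] simp del: power_Suc)
  moreover have "\<phi> y = 0" if "y \<notin> U" for y
  proof -
    have "r \<le> norm (y - x)" using r that by (force simp: dist_norm norm_minus_commute)
    then have "r\<^sup>2 \<le> norm (y - x) ^ 2" using r(1) by (intro power_mono) auto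
    also have "\<dots> = (\<Sum>i\<in>UNIV. (y $ i - x $ i) ^ 2)"
      unfolding power2_norm_eq_inner inner_vec_def by (simp add: power2_eq_square)
    finally show ?thesis using r(1) by (simp add: \<phi>_def max_def)
  qed
  ultimately show thesis using that[of \<phi>] by (simp add: \<phi>_def)
qed

lemma additive_operator_nat_mult:
  assumes S: "Ck_operator k \<Omega> S" "additive_operator k \<Omega> S" and f: "f \<in> Ck k \<Omega>" and x: "x \<in> \<Omega>"
  shows "S (\<lambda>y. real m * f y) x = real m * S f x"
proof (induction m)
  case (Suc m)
  have "S (\<lambda>y. real (Suc m) * f y) x = S (\<lambda>y. real m * f y + f y) x"
    by (simp add: algebra_simps)
  also have "\<dots> = S (\<lambda>y. real m * f y) x + S f x"
    by (intro additive_operator_add[OF S(2)] Ck_intros f x)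
  finally show ?case using Suc by (simp add: algebra_simps)
qed (use additive_operator_zero[OF op S x] in simp)

text \<open>Since \<open>T\<close> and \<open>A\<close> kill 1, the coefficients of m^2 in the
  identity for 1 + m f are binom(n,2) T(f^2) and n (n - 1) (f T(f) + A(f)^2), and binom(n,2) is half
  of n (n - 1).\<close>

lemma power_identity_square:
  assumes T: "Ck_operator k \<Omega> T" "additive_operator k \<Omega> T"
    and A: "Ck_operator k \<Omega> A" "additive_operator k \<Omega> A"
    and pow: "power_identity n k \<Omega> T A" and n: "n \<ge> 2" and A1: "\<And>x. x \<in> \<Omega> \<Longrightarrow> A (\<lambda>_. 1) x = 0"
    and f: "f \<in> Ck k \<Omega>" and x: "x \<in> \<Omega>"
  shows "T (\<lambda>y. f y * f y) x = 2 * f x * T f x + 2 * A f x * A f x"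
proof -
  have T1: "T (\<lambda>_. 1) x = 0"
  proof -
    have "T (\<lambda>y. 1 ^ n) x = real n * 1 ^ (n - 1) * T (\<lambda>_. 1) x + real n * A (\<lambda>_. 1) x * A (\<lambda>y. 1 ^ (n - 1)) x"
      by (rule pow[unfolded power_identity_def, rule_format, OF Ck_const[of 1] x])
    then have "T (\<lambda>_. 1) x = real n * T (\<lambda>_. 1) x" using A1[OF x] by simp
    then show ?thesis using n by (cases "T (\<lambda>_. 1) x = 0") auto
  qed
  \<comment> \<open>\<open>\<alpha> j\<close> is the coefficient of m^j on the left,
    \<open>\<beta> j\<close> that of m^(j + 1) on the right; the extra m comes from T(1 + m f) = m
    T(f) and the same for \<open>A\<close>.\<close>
  define \<alpha> where "\<alpha> = (\<lambda>j. real (n choose j) * T (\<lambda>y. f y ^ j) x)"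
  define \<beta> where "\<beta> = (\<lambda>j. real n * real ((n - 1) choose j) * (f x ^ j * T f x + A f x * A (\<lambda>y. f y ^ j) x))"
  have expand: "S (\<lambda>y. (1 + real m * f y) ^ N) x = (\<Sum>j\<le>N. real (N choose j) * S (\<lambda>y. f y ^ j) x * real m ^ j)"
    if S: "Ck_operator k \<Omega> S" "additive_operator k \<Omega> S" for S m N
  proof -
    have "(1 + real m * f y) ^ N = (\<Sum>j\<le>N. real ((N choose j) * m ^ j) * f y ^ j)" for y
      using binomial_ring[of "real m * f y" 1 N] by (simp add: add.commute power_mult_distrib mult.assoc)
    then have "S (\<lambda>y. (1 + real m * f y) ^ N) x = S (\<lambda>y. \<Sum>j\<le>N. real ((N choose j) * m ^ j) * f y ^ j) x"
      by simp
    also have "\<dots> = (\<Sum>j\<le>N. S (\<lambda>y. real ((N choose j) * m ^ j) * f y ^ j) x)"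
      by (intro additive_operator_sum[OF op S] Ck_intros f x)
    also have "\<dots> = (\<Sum>j\<le>N. real ((N choose j) * m ^ j) * S (\<lambda>y. f y ^ j) x)"
      by (intro sum.cong refl additive_operator_nat_mult[OF S] Ck_intros f x)
    finally show ?thesis by (simp add: ac_simps)
  qed
  have "(\<Sum>j\<le>n. \<alpha> j * real m ^ j) = (\<Sum>j<n. \<beta> j * real m ^ Suc j)" for m
  proof -
    let ?g = "\<lambda>y. 1 + real m * f y"
    have lin: "S ?g x = S (\<lambda>_. 1) x + real m * S f x"
      if S: "Ck_operator k \<Omega> S" "additive_operator k \<Omega> S" for S
      using additive_operator_add[OF S(2) Ck_const[of 1], of "\<lambda>y. real m * f y" x]
        additive_operator_nat_mult[OF S f x] x Ck_intros f by simp
    have g: "?g \<in> Ck k \<Omega>" by (intro Ck_intros f)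
    have bin: "?g x ^ (n - 1) = (\<Sum>j\<le>n - 1. real ((n - 1) choose j) * f x ^ j * real m ^ j)"
      using binomial_ring[of "real m * f x" 1 "n - 1"] by (simp add: add.commute power_mult_distrib ac_simps)
    have "(\<Sum>j\<le>n. \<alpha> j * real m ^ j) = T (\<lambda>y. ?g y ^ n) x"
      unfolding expand[OF T] \<alpha>_def ..
    also have "\<dots> = real n * ?g x ^ (n - 1) * T ?g x + real n * A ?g x * A (\<lambda>y. ?g y ^ (n - 1)) x"
      by (rule pow[unfolded power_identity_def, rule_format, OF g x])
    also have "\<dots> = real n * ?g x ^ (n - 1) * (real m * T f x) + real n * (real m * A f x) * A (\<lambda>y. ?g y ^ (n - 1)) x"
      unfolding lin[OF T] lin[OF A] T1 A1[OF x] by simp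
    also have "\<dots> = (\<Sum>j\<le>n - 1. \<beta> j * real m ^ Suc j)"
      unfolding bin expand[OF A] \<beta>_def sum_distrib_left sum_distrib_right sum.distrib[symmetric]
      by (intro sum.cong refl) (simp add: algebra_simps)
    also have "{..n - 1} = {..<n}" using n by auto
    finally show ?thesis .
  qed
  from polyfun_nat_coeff[OF this, of 1] n have "\<alpha> 2 = \<beta> 1" by (simp add: numeral_2_eq_2)
  then have "real (n choose 2) * T (\<lambda>y. f y ^ 2) x = real n * real (n - 1) * (f x * T f x + A f x * A f x)"
    by (simp add: \<alpha>_def \<beta>_def)
  then have "(2 * real (n choose 2)) * T (\<lambda>y. f y ^ 2) x
      = (real n * real (n - 1)) * (2 * (f x * T f x + A f x * A f x))"
    by (simp only: mult.assoc mult.left_commute[of 2])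
  moreover have "2 * (n choose 2) = n * (n - 1)" using times_binomial_minus1_eq[of 2 n] by simp
  then have "2 * real (n choose 2) = real n * real (n - 1)"
    by (metis of_nat_mult of_nat_numeral)
  ultimately have "(real n * real (n - 1)) * T (\<lambda>y. f y ^ 2) x
      = (real n * real (n - 1)) * (2 * (f x * T f x + A f x * A f x))"
    by simp
  then show ?thesis using n by (simp add: power2_eq_square)
qed

definition second_leibniz where
  "second_leibniz T A \<longleftrightarrow> (\<forall>f\<in>Ck k \<Omega>. \<forall>g\<in>Ck k \<Omega>. \<forall>x\<in>\<Omega>.
     T (\<lambda>y. f y * g y) x = f x * T g x + g x * T f x + 2 * A f x * A g x)"

definition leibniz where
  "leibniz A \<longleftrightarrow> (\<forall>f\<in>Ck k \<Omega>. \<forall>g\<in>Ck k \<Omega>. \<forall>x\<in>\<Omega>. A (\<lambda>y. f y * g y) x = f x * A g x + g x * A f x)"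

lemma second_leibnizD: "second_leibniz T A \<Longrightarrow> f \<in> Ck k \<Omega> \<Longrightarrow> g \<in> Ck k \<Omega> \<Longrightarrow> x \<in> \<Omega> \<Longrightarrow>
     T (\<lambda>y. f y * g y) x = f x * T g x + g x * T f x + 2 * A f x * A g x"
  by (simp add: second_leibniz_def)

lemma leibnizD: "leibniz A \<Longrightarrow> f \<in> Ck k \<Omega> \<Longrightarrow> g \<in> Ck k \<Omega> \<Longrightarrow> x \<in> \<Omega> \<Longrightarrow>
     A (\<lambda>y. f y * g y) x = f x * A g x + g x * A f x"
  by (simp add: leibniz_def)

text \<open>Polarisation: the quadratic identity for f + g, minus those for f and g.\<close>

lemma power_identity_imp_second_leibniz:
  assumes T: "Ck_operator k \<Omega> T" "additive_operator k \<Omega> T"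
    and A: "Ck_operator k \<Omega> A" "additive_operator k \<Omega> A"
    and pow: "power_identity n k \<Omega> T A" and n: "n \<ge> 2" and A1: "\<And>x. x \<in> \<Omega> \<Longrightarrow> A (\<lambda>_. 1) x = 0"
  shows "second_leibniz T A"
  unfolding second_leibniz_def
proof (intro ballI)
  fix f g x assume f: "f \<in> Ck k \<Omega>" and g: "g \<in> Ck k \<Omega>" and x: "x \<in> \<Omega>"
  have sq: "T (\<lambda>y. h y * h y) x = 2 * h x * T h x + 2 * A h x * A h x" if "h \<in> Ck k \<Omega>" for h
    using power_identity_square[OF T A pow n _ that x] A1 by blast
  note add = additive_operator_add[OF _ _ _ x]
  have "T (\<lambda>y. (f y + g y) * (f y + g y)) x
      = T (\<lambda>y. (f y * f y + g y * g y) + (f y * g y + f y * g y)) x"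
    by (simp add: algebra_simps)
  also have "\<dots> = T (\<lambda>y. f y * f y) x + T (\<lambda>y. g y * g y) x + 2 * T (\<lambda>y. f y * g y) x"
    using add[OF T(2) Ck_add[OF Ck_mult[OF f f] Ck_mult[OF g g]] Ck_add[OF Ck_mult[OF f g] Ck_mult[OF f g]]]
      add[OF T(2) Ck_mult[OF f f] Ck_mult[OF g g]] add[OF T(2) Ck_mult[OF f g] Ck_mult[OF f g]] by simp
  finally show "T (\<lambda>y. f y * g y) x = f x * T g x + g x * T f x + 2 * A f x * A g x"
    using sq[OF f] sq[OF g] sq[OF Ck_add[OF f g]] add[OF T(2) f g] add[OF A(2) f g]
    by (simp add: algebra_simps)
qed

text \<open>
  Associativity of the product forces \<open>A (f g) - f A g - g A f = \<theta> A f A g\<close> at each point. If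
  \<open>\<theta> \<noteq> 0\<close>, then \<open>f \<mapsto> f x + \<theta> A f x\<close> is a ring homomorphism into the reals, hence positive; but
  then it must kill every function supported near \<open>x\<close>, which contradicts non-degeneracy.
\<close>

lemma second_leibniz_imp_leibniz:
  assumes T: "second_leibniz T A"
    and A: "Ck_operator k \<Omega> A" "additive_operator k \<Omega> A" and nd: "non_degenerate k \<Omega> A"
    and A1: "\<And>x. x \<in> \<Omega> \<Longrightarrow> A (\<lambda>_. 1) x = 0"
  shows "leibniz A"
  unfolding leibniz_def
proof (intro ballI)
  fix u v x assume u: "u \<in> Ck k \<Omega>" and v: "v \<in> Ck k \<Omega>" and x: "x \<in> \<Omega>"
  define D where "D = (\<lambda>f g. A (\<lambda>y. f y * g y) x - f x * A g x - g x * A f x)"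
  \<comment> \<open>Both bracketings of f g h are expanded by the second-order rule; all terms with
    \<open>T\<close> cancel, which leaves a relation between the defects \<open>D\<close>.\<close>
  have assoc: "A h x * D f g = A f x * D g h" if "f \<in> Ck k \<Omega>" "g \<in> Ck k \<Omega>" "h \<in> Ck k \<Omega>" for f g h
  proof -
    have "T (\<lambda>y. (f y * g y) * h y) x = T (\<lambda>y. f y * (g y * h y)) x"
      by (simp add: mult.assoc)
    moreover have "T (\<lambda>y. (f y * g y) * h y) x = f x * g x * T h x
        + h x * (f x * T g x + g x * T f x + 2 * A f x * A g x) + 2 * A (\<lambda>y. f y * g y) x * A h x"
      using second_leibnizD[OF T Ck_mult[OF that(1,2)] that(3) x] second_leibnizD[OF T that(1,2) x] by simp
    moreover have "T (\<lambda>y. f y * (g y * h y)) x = f x * (g x * T h x + h x * T g x + 2 * A g x * A h x)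
        + g x * h x * T f x + 2 * A f x * A (\<lambda>y. g y * h y) x"
      using second_leibnizD[OF T that(1) Ck_mult[OF that(2,3)] x] second_leibnizD[OF T that(2,3) x] by simp
    ultimately show ?thesis by (simp add: D_def algebra_simps)
  qed
  obtain f0 where f0: "f0 \<in> Ck k \<Omega>" "A f0 x \<noteq> 0"
  proof -
    obtain g1 g2 where g: "g1 \<in> Ck k \<Omega>" "g2 \<in> Ck k \<Omega>" "g1 x * A g2 x \<noteq> A g1 x * g2 x"
      using non_degenerateD[OF nd op order_refl x] by metis
    then have "A g1 x \<noteq> 0 \<or> A g2 x \<noteq> 0" by auto
    then show thesis using g that by blast
  qed
  define \<theta> where "\<theta> = D f0 f0 / (A f0 x * A f0 x)"
  have D_sym: "D f g = D g f" for f g by (simp add: D_def mult.commute)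
  \<comment> \<open>Two uses of the relation replace first f and then g by the reference function
    \<open>f0\<close>, producing the factors A(f) and A(g).\<close>
  have D_eq: "D f g = \<theta> * A f x * A g x" if f: "f \<in> Ck k \<Omega>" and g: "g \<in> Ck k \<Omega>" for f g
  proof -
    have "A f0 x * D f g = A f x * D g f0" by (rule assoc[OF f g f0(1)])
    moreover have "A f0 x * D g f0 = A g x * D f0 f0" by (rule assoc[OF g f0(1) f0(1)])
    ultimately have "(A f0 x * A f0 x) * D f g = A f x * A g x * D f0 f0"
      by (simp add: mult.assoc mult.left_commute)
    then show ?thesis using f0(2) by (simp add: \<theta>_def field_simps)
  qed
  have "\<theta> = 0"
  proof (rule ccontr)
    assume \<theta>: "\<theta> \<noteq> 0"
    \<comment> \<open>Multiplying the rule for A(f g) by \<theta> and adding f g lets the right side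
      factor, which makes this map multiplicative.\<close>
    define M where "M = (\<lambda>f. f x + \<theta> * A f x)"
    have M_add: "M (\<lambda>y. f y + g y) = M f + M g" if "f \<in> Ck k \<Omega>" "g \<in> Ck k \<Omega>" for f g
      using additive_operator_add[OF A(2) that x] by (simp add: M_def algebra_simps)
    have M_diff: "M (\<lambda>y. f y - g y) = M f - M g" if "f \<in> Ck k \<Omega>" "g \<in> Ck k \<Omega>" for f g
      unfolding M_def additive_operator_diff[OF op A that x] by (simp add: algebra_simps)
    have M_mult: "M (\<lambda>y. f y * g y) = M f * M g" if "f \<in> Ck k \<Omega>" "g \<in> Ck k \<Omega>" for f g
    proof -
      have "A (\<lambda>y. f y * g y) x = f x * A g x + g x * A f x + \<theta> * A f x * A g x"
        using D_eq[OF that] by (simp add: D_def)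
      then show ?thesis by (simp add: M_def algebra_simps)
    qed
    have M_const: "M (\<lambda>_. r) = r" for r
    proof (rule real_ring_hom_id[where \<mu> = "\<lambda>r. M (\<lambda>_. r)"])
      show "M (\<lambda>_. a + b) = M (\<lambda>_. a) + M (\<lambda>_. b)" for a b by (rule M_add[OF Ck_const Ck_const])
      show "M (\<lambda>_. a * b) = M (\<lambda>_. a) * M (\<lambda>_. b)" for a b by (rule M_mult[OF Ck_const Ck_const])
      show "M (\<lambda>_. 1) = 1" by (simp add: M_def A1[OF x])
    qed
    have M_pos: "M f \<ge> 0" if f: "f \<in> Ck k \<Omega>" "\<And>y. y \<in> \<Omega> \<Longrightarrow> f y \<ge> 0" for f
    proof -
      \<comment> \<open>At its zeros f may fail to have a square root of class C^k, but f +
        \<epsilon> has one, and a homomorphism maps squares to squares.\<close>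
      have "0 \<le> M f + \<epsilon>" if "\<epsilon> > 0" for \<epsilon>
      proof -
        define g where "g = (\<lambda>y. (f y + \<epsilon>) powr (1 / 2))"
        have "(\<lambda>y. f y + \<epsilon>) \<in> Ck k \<Omega>" by (intro Ck_intros f)
        then have g: "g \<in> Ck k \<Omega>"
          unfolding g_def Ck_def using f(2) that by (auto intro!: cont_diff_on_powr[OF op] add_nonneg_pos)
        have "g y * g y = f y + \<epsilon>" if "y \<in> \<Omega>" for y
          using f(2)[OF that] \<open>\<epsilon> > 0\<close> by (simp add: g_def flip: powr_add)
        then have "M (\<lambda>y. g y * g y) = M (\<lambda>y. f y + \<epsilon>)"
          using Ck_operator_cong[OF op A(1), of "\<lambda>y. g y * g y" "\<lambda>y. f y + \<epsilon>" x] x Ck_mult[OF g g]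
          by (simp add: M_def A)
        then have "M g * M g = M f + \<epsilon>"
          using M_mult[OF g g] M_add[OF f(1) Ck_const] M_const by simp
        then show ?thesis using zero_le_square[of "M g"] by linarith
      qed
      then show ?thesis by (rule field_le_epsilon)
    qed
    \<comment> \<open>\<open>M\<close> is not evaluation at x: d vanishes at x, but
      \<open>M d\<close> does not. Its square h is then 0 at x with \<open>M h > 0\<close>, and the
      level \<open>M h / 2\<close> separates these two values.\<close>
    define d where "d = (\<lambda>y. f0 y - f0 x)"
    define h where "h = (\<lambda>y. d y * d y)"
    have d: "d \<in> Ck k \<Omega>" unfolding d_def by (intro Ck_intros f0)
    have h: "h \<in> Ck k \<Omega>" unfolding h_def by (intro Ck_intros d)
    have "M d = \<theta> * A f0 x"
      unfolding d_def using M_diff[OF f0(1) Ck_const] M_const by (simp add: M_def)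
    then have "M d \<noteq> 0" using \<theta> f0(2) by simp
    moreover have "M h = M d * M d" unfolding h_def by (rule M_mult[OF d d])
    ultimately have Mh: "M h > 0" by (simp add: zero_less_mult_iff linorder_neq_iff disj_commute)
    define U where "U = {y \<in> \<Omega>. h y < M h / 2}"
    have "continuous_on \<Omega> h" using h cont_diff_on_continuous[OF op] by (auto simp: Ck_def)
    then have "open (h -` {..<M h / 2} \<inter> \<Omega>)"
      using op by (simp add: continuous_on_open_vimage)
    moreover have "U = h -` {..<M h / 2} \<inter> \<Omega>" by (auto simp: U_def)
    ultimately have "open U" by simp
    have "x \<in> U" using x Mh by (simp add: U_def h_def d_def)
    have M0: "g x + \<theta> * A g x = 0" if g: "g \<in> Ck k \<Omega>" "support_in \<Omega> g \<subseteq> U" for g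
    proof -
      have g0: "g y = 0" if "y \<in> \<Omega>" "y \<notin> U" for y
        using that g(2) closure_subset[of "support_on \<Omega> g"]
        by (auto simp: support_in_def support_on_def)
      \<comment> \<open>Nonnegative because g vanishes off U and h is below \<open>M h / 2\<close>
        on U. But \<open>M\<close> maps the second factor to the negative number
        \<open>- M h / 2\<close>, so positivity forces \<open>M g = 0\<close>.\<close>
      let ?w = "\<lambda>y. (g y * g y) * (M h / 2 - h y)"
      have "M ?w \<ge> 0"
      proof (rule M_pos)
        show "?w \<in> Ck k \<Omega>" by (intro Ck_intros g h)
        show "?w y \<ge> 0" if "y \<in> \<Omega>" for y
          using g0[OF that] that by (cases "y \<in> U") (auto simp: U_def)
      qed
      moreover have "M ?w = (M g * M g) * (M h / 2 - M h)"
        using M_mult[OF Ck_mult[OF g(1) g(1)] Ck_diff[OF Ck_const h]] M_mult[OF g(1) g(1)]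
          M_diff[OF Ck_const h] M_const by simp
      ultimately have "(M g * M g) * M h \<le> 0" by (simp add: algebra_simps)
      then have "M g * M g \<le> 0" using Mh by (simp add: mult_le_0_iff)
      then have "M g = 0" using zero_le_square[of "M g"] by (simp add: antisym_conv)
      then show ?thesis by (simp add: M_def)
    qed
    have "U \<subseteq> \<Omega>" by (auto simp: U_def)
    then obtain g1 g2 where g: "g1 \<in> Ck k \<Omega>" "g2 \<in> Ck k \<Omega>" "support_in \<Omega> g1 \<subseteq> U" "support_in \<Omega> g2 \<subseteq> U"
      "g1 x * A g2 x \<noteq> A g1 x * g2 x"
      using non_degenerateD[OF nd \<open>open U\<close> _ \<open>x \<in> U\<close>] by metis
    \<comment> \<open>Both vectors (g x, A g x) lie on one line, against their independence.\<close>
    have "g1 x = - \<theta> * A g1 x" "g2 x = - \<theta> * A g2 x"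
      using M0[OF g(1,3)] M0[OF g(2,4)] by simp_all
    then show False using g(5) by simp
  qed
  then show "A (\<lambda>y. u y * v y) x = u x * A v x + v x * A u x"
    using D_eq[OF u v] by (simp add: D_def)
qed

end

subsection \<open>Operators satisfying the Leibniz rules\<close>

context
  fixes \<Omega> :: "(real ^ 'N) set" and k :: nat and T A
  assumes op: "open \<Omega>"
    and T: "Ck_operator k \<Omega> T" "additive_operator k \<Omega> T"
    and A: "Ck_operator k \<Omega> A" "additive_operator k \<Omega> A"
    and T_leibniz: "second_leibniz \<Omega> k T A" and A_leibniz: "leibniz \<Omega> k A"
begin

lemmas Ck_closed = Ck_intros[OF op]

lemma A_mult: "f \<in> Ck k \<Omega> \<Longrightarrow> g \<in> Ck k \<Omega> \<Longrightarrow> x \<in> \<Omega> \<Longrightarrow>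
    A (\<lambda>y. f y * g y) x = f x * A g x + g x * A f x"
  by (rule leibnizD[OF op A_leibniz])

lemma T_mult: "f \<in> Ck k \<Omega> \<Longrightarrow> g \<in> Ck k \<Omega> \<Longrightarrow> x \<in> \<Omega> \<Longrightarrow>
    T (\<lambda>y. f y * g y) x = f x * T g x + g x * T f x + 2 * A f x * A g x"
  by (rule second_leibnizD[OF op T_leibniz])

text \<open>The product rules are applied to \<phi> f = 0, where \<phi> vanishes off U and is 1 at
  x. As f(x) = 0, the rule for \<open>A\<close> gives A(f)(x) = 0, and then the cross term in the
  rule for \<open>T\<close> vanishes too.\<close>

lemma A_T_local: "local_operator k \<Omega> A" "local_operator k \<Omega> T"
proof -
  have "A f x = 0 \<and> T f x = 0"
    if f: "f \<in> Ck k \<Omega>" and U: "open U" "U \<subseteq> \<Omega>" "x \<in> U" "\<And>x. x \<in> U \<Longrightarrow> f x = 0" for f U x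
  proof -
    obtain \<phi> where \<phi>: "\<phi> \<in> Ck k \<Omega>" "\<phi> x = 1" "\<And>y. y \<notin> U \<Longrightarrow> \<phi> y = 0"
      using bump_function[OF op U(1,3)] by metis
    have x: "x \<in> \<Omega>" "f x = 0" using U by auto
    have "(\<lambda>y. \<phi> y * f y) = (\<lambda>_. 0)"
    proof
      show "\<phi> y * f y = 0" for y using \<phi>(3) U(4) by (cases "y \<in> U") auto
    qed
    then have "A (\<lambda>y. \<phi> y * f y) x = 0" "T (\<lambda>y. \<phi> y * f y) x = 0"
      using additive_operator_zero[OF op A x(1)] additive_operator_zero[OF op T x(1)] by simp_all
    then show ?thesis
      using A_mult[OF \<phi>(1) f x(1)] T_mult[OF \<phi>(1) f x(1)] \<phi>(2) x(2) by simp
  qed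
  then show "local_operator k \<Omega> A" "local_operator k \<Omega> T"
    unfolding local_operator_def by blast+
qed

lemma A_const: "x \<in> \<Omega> \<Longrightarrow> A (\<lambda>_. r) x = 0"
proof (rule operator_constant_eq_0[OF op A])
  show "A (\<lambda>y. r * \<phi> y) x = r * A \<phi> x + \<phi> x * A (\<lambda>_. r) x" if "\<phi> \<in> Ck k \<Omega>" "x \<in> \<Omega>" for r \<phi> x
    by (rule A_mult[OF Ck_closed(1) that])
  show "A (\<lambda>y. g y ^ 3 * h y) x = 0" if g: "g \<in> Ck k \<Omega>" and h: "h \<in> Ck k \<Omega>" and x: "x \<in> \<Omega>" "g x = 0" for g h x
    using A_mult[OF Ck_closed(6)[OF g, of 2] Ck_closed(5)[OF g h] x(1)] x(2)
    by (simp add: power2_eq_square power3_eq_cube mult.assoc)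
qed

text \<open>Constants must be settled for \<open>A\<close> first: only then does the cross term
  disappear for scalar multiples. The cube is what a second-order rule requires, since a double zero
  g (g h) would leave 2 h A(g)^2.\<close>

lemma T_const: "x \<in> \<Omega> \<Longrightarrow> T (\<lambda>_. r) x = 0"
proof (rule operator_constant_eq_0[OF op T])
  show "T (\<lambda>y. r * \<phi> y) x = r * T \<phi> x + \<phi> x * T (\<lambda>_. r) x" if "\<phi> \<in> Ck k \<Omega>" "x \<in> \<Omega>" for r \<phi> x
    using T_mult[OF Ck_closed(1) that] A_const[OF that(2)] by simp
  show "T (\<lambda>y. g y ^ 3 * h y) x = 0" if g: "g \<in> Ck k \<Omega>" and h: "h \<in> Ck k \<Omega>" and x: "x \<in> \<Omega>" "g x = 0" for g h x
  proof -
    have "T (\<lambda>y. g y * (g y * (g y * h y))) x = 0"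
      using T_mult[OF g Ck_closed(5)[OF g Ck_closed(5)[OF g h]] x(1)] A_mult[OF g Ck_closed(5)[OF g h] x(1)] x(2) by simp
    then show ?thesis by (simp add: power3_eq_cube mult.assoc)
  qed
qed

lemma A_cmult: "f \<in> Ck k \<Omega> \<Longrightarrow> x \<in> \<Omega> \<Longrightarrow> A (\<lambda>y. r * f y) x = r * A f x"
  using A_mult[OF Ck_closed(1), of f x r] A_const[of x r] by simp

lemma T_cmult: "f \<in> Ck k \<Omega> \<Longrightarrow> x \<in> \<Omega> \<Longrightarrow> T (\<lambda>y. r * f y) x = r * T f x"
  using T_mult[OF Ck_closed(1), of f x r] A_const[of x r] T_const[of x r] by simp

definition A_coeff :: "real ^ 'N \<Rightarrow> real ^ 'N" where "A_coeff x = (\<chi> i. A (\<lambda>y. y $ i) x)"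
definition T_coeff :: "real ^ 'N \<Rightarrow> real ^ 'N" where "T_coeff x = (\<chi> i. T (\<lambda>y. y $ i) x)"

lemma continuous_coeffs: "continuous_on \<Omega> A_coeff" "continuous_on \<Omega> T_coeff"
  unfolding A_coeff_def[abs_def] T_coeff_def[abs_def]
  using Ck_operator_continuous[OF op A Ck_closed(2)] Ck_operator_continuous[OF op T Ck_closed(2)]
  by (auto intro: continuous_on_vec_lambda)

text \<open>Polynomials are generated by constants and linear functions, and both sides are additive
  and obey the same product rules. The directions are frozen at x, so the coefficient fields are
  never differentiated.\<close>

lemma A_T_polynomial:
  assumes "real_polynomial_function p" and x: "x \<in> \<Omega>"
  shows "A p x = dird (A_coeff x) p x \<and>
    T p x = dird (A_coeff x) (dird (A_coeff x) p) x + dird (T_coeff x) p x"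
  using assms(1)
proof (induction rule: real_polynomial_function.induct)
  case (linear f)
  have f: "f y = (\<Sum>i\<in>UNIV. f (axis i 1) * y $ i)" for y
  proof -
    have "f y = f (\<Sum>i\<in>UNIV. y $ i *\<^sub>R axis i 1)"
      by (simp add: basis_expansion flip: scalar_mult_eq_scaleR)
    then show ?thesis
      using linear by (simp add: bounded_linear.linear linear_sum linear_cmul mult.commute)
  qed
  have "A f x = A (\<lambda>y. \<Sum>i\<in>UNIV. f (axis i 1) * y $ i) x" using f by (metis ext)
  also have "\<dots> = (\<Sum>i\<in>UNIV. A (\<lambda>y. f (axis i 1) * y $ i) x)"
    by (intro additive_operator_sum[OF op A] Ck_closed x)
  also have "\<dots> = f (A_coeff x)"
    by (subst f) (simp add: A_coeff_def A_cmult Ck_closed x)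
  finally have A: "A f x = f (A_coeff x)" .
  have "T f x = T (\<lambda>y. \<Sum>i\<in>UNIV. f (axis i 1) * y $ i) x" using f by (metis ext)
  also have "\<dots> = (\<Sum>i\<in>UNIV. T (\<lambda>y. f (axis i 1) * y $ i) x)"
    by (intro additive_operator_sum[OF op T] Ck_closed x)
  also have "\<dots> = f (T_coeff x)"
    by (subst f) (simp add: T_coeff_def T_cmult Ck_closed x)
  finally have "T f x = f (T_coeff x)" .
  moreover have "dird v f = (\<lambda>_. f v)" for v
    by (rule ext) (rule dird_linear[OF linear])
  ultimately show ?case using A by simp
next
  case (const c)
  then show ?case using A_const[OF x] T_const[OF x] by (simp add: dird_const[abs_def])
next
  case (add f g)
  note fg = add(1,2)[THEN cont_diff_on_polynomial[OF op]] and fg' = add(1,2)[THEN cont_diff_on_polynomial[OF open_UNIV], of 2]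
  have "f differentiable (at y)" "g differentiable (at y)"
    "dird v f differentiable (at y)" "dird v g differentiable (at y)" for v y
    using fg' by (auto simp: numeral_2_eq_2 cont_diff_on_Suc)
  moreover from this have "dird v (\<lambda>x. f x + g x) = (\<lambda>x. dird v f x + dird v g x)" for v
    by (intro ext dird_add)
  ultimately show ?case
    using add(3,4) fg additive_operator_add[OF A(2), of f g x] additive_operator_add[OF T(2), of f g x] x
    by (simp add: Ck_def dird_add)
next
  case (mult f g)
  note fg = mult(1,2)[THEN cont_diff_on_polynomial[OF op]] and fg' = mult(1,2)[THEN cont_diff_on_polynomial[OF open_UNIV], of 2]
  have d: "f differentiable (at y)" "g differentiable (at y)"
    "dird v f differentiable (at y)" "dird v g differentiable (at y)" for v y
    using fg' by (auto simp: numeral_2_eq_2 cont_diff_on_Suc)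
  moreover from this have "dird v (\<lambda>x. f x * g x) = (\<lambda>x. f x * dird v g x + dird v f x * g x)" for v
    by (intro ext dird_mult)
  ultimately show ?case
    using mult(3,4) fg A_mult[of f g x] T_mult[of f g x] x
    by (simp add: Ck_def dird_add dird_mult algebra_simps)
qed

lemma A_coeff_eq_0:
  assumes "k \<le> 1" "x \<in> \<Omega>"
  shows "A_coeff x = 0"
proof -
  have "A (\<lambda>y. y $ i) x = 0" for i
  proof -
    let ?d = "\<lambda>y::real ^ 'N. y $ i - x $ i"
    have d: "?d \<in> Ck k \<Omega>" by (intro Ck_closed)
    have Ad: "A ?d x = A (\<lambda>y. y $ i) x"
      using additive_operator_diff[OF op A Ck_closed(2,1) assms(2)] A_const[OF assms(2)] by simp
    \<comment> \<open>Vanishing value and first derivatives suffice, as \<open>T\<close> sees only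
      the k-jet and k is at most 1.\<close>
    have "flat 1 x (\<lambda>y. ?d y * ?d y)"
      by (auto simp: dird_mult dird_diff)
    then have "flat k x (\<lambda>y. ?d y * ?d y)" using assms(1) by (auto simp: le_Suc_eq)
    then have "T (\<lambda>y. ?d y * ?d y) x = 0"
      by (intro operator_flat_eq_0[OF op T A_T_local(2) assms(2)] Ck_closed)
    then have "A ?d x = 0" using T_mult[OF d d assms(2)] by simp
    with Ad show ?thesis by simp
  qed
  then show ?thesis by (simp add: A_coeff_def vec_eq_iff)
qed

lemma T_coeff_eq_0:
  assumes "k = 0" "x \<in> \<Omega>"
  shows "T_coeff x = 0"
proof -
  have "T (\<lambda>y. y $ i) x = 0" for i
  proof -
    have "T (\<lambda>y. y $ i - x $ i) x = 0"
      using assms by (intro operator_flat_eq_0[OF op T A_T_local(2) assms(2)] Ck_closed) auto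
    then show ?thesis
      using additive_operator_diff[OF op T Ck_closed(2,1) assms(2)] T_const[OF assms(2)] by simp
  qed
  then show ?thesis by (simp add: T_coeff_def vec_eq_iff)
qed

lemma A_eq_dird:
  assumes "f \<in> Ck k \<Omega>" "x \<in> \<Omega>"
  shows "A f x = (if 1 \<le> k then dird (A_coeff x) f x else 0)"
proof -
  have p: "A f x = dird (A_coeff x) (taylor_poly k x f) x"
    using operator_eq_taylor[OF op A A_T_local(1) assms(2,1)] A_T_polynomial[OF taylor_poly_polynomial assms(2)]
    by simp
  have diff: "taylor_poly k x f differentiable (at y)" for y
    using cont_diff_on_differentiable[OF open_UNIV cont_diff_on_polynomial[OF open_UNIV
      taylor_poly_polynomial], of 1] by simp
  show ?thesis
  proof (cases k)
    case 0
    then show ?thesis using p A_coeff_eq_0[of x] assms(2) diff by simp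
  next
    case (Suc m)
    have "dird v (taylor_poly k x f) x = dird v f x" for v
      using dird_taylor_poly[OF op assms(2), of m f v x] assms(1) flat_zero[OF flat_taylor_remainder[OF op assms(2), of m "dird v f"]]
      by (simp add: Suc Ck_def cont_diff_on_Suc)
    with p Suc show ?thesis by simp
  qed
qed

text \<open>Derivatives of a Taylor polynomial are Taylor polynomials of the derivatives, so the
  formula for polynomials carries over at x. For k at most 1 its second-order term has no
  counterpart for f and drops out because \<open>A_coeff x\<close> is 0.\<close>

lemma T_eq_dird:
  assumes "f \<in> Ck k \<Omega>" "x \<in> \<Omega>"
  shows "T f x = (if 2 \<le> k then dird (A_coeff x) (dird (A_coeff x) f) x else 0)
    + (if 1 \<le> k then dird (T_coeff x) f x else 0)"
proof -
  let ?p = "taylor_poly k x f" and ?c = "A_coeff x"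
  have p: "T f x = dird ?c (dird ?c ?p) x + dird (T_coeff x) ?p x"
    using operator_eq_taylor[OF op T A_T_local(2) assms(2,1)] A_T_polynomial[OF taylor_poly_polynomial assms(2)]
    by simp
  have poly2: "cont_diff_on 2 UNIV ?p"
    by (intro cont_diff_on_polynomial open_UNIV taylor_poly_polynomial)
  then have diff: "?p differentiable (at y)" "dird v ?p differentiable (at y)" for v y
    by (auto simp: numeral_2_eq_2 cont_diff_on_Suc)
  have first: "dird v ?p x = dird v f x" if "k = Suc m" for v m
    using dird_taylor_poly[OF op assms(2), of m f v x] assms(1) flat_zero[OF flat_taylor_remainder[OF op assms(2), of m "dird v f"]]
    by (simp add: that Ck_def cont_diff_on_Suc)
  consider "k = 0" | "k = 1" | m where "k = Suc (Suc m)"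
    by (metis One_nat_def not0_implies_Suc)
  then show ?thesis
  proof cases
    case 1
    then show ?thesis using p A_coeff_eq_0[of x] T_coeff_eq_0[of x] assms(2) diff by simp
  next
    case 2
    then show ?thesis using p A_coeff_eq_0[of x] first[of 0] assms(2) diff by simp
  next
    case (3 m)
    have f: "cont_diff_on (Suc (Suc m)) \<Omega> f" "cont_diff_on (Suc m) \<Omega> (dird v f)" for v
      using assms(1) by (auto simp: 3 Ck_def cont_diff_on_Suc)
    have "dird ?c ?p = taylor_poly (Suc m) x (dird ?c f)"
      unfolding 3 by (intro ext dird_taylor_poly[OF op assms(2) f(1)])
    then have "dird ?c (dird ?c ?p) x = taylor_poly m x (dird ?c (dird ?c f)) x"
      using dird_taylor_poly[OF op assms(2) f(2)] by simp
    also have "\<dots> = dird ?c (dird ?c f) x"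
      using flat_zero[OF flat_taylor_remainder[OF op assms(2), of m "dird ?c (dird ?c f)"]] f(2)
      by (simp add: cont_diff_on_Suc)
    finally show ?thesis using p first[of "Suc m"] 3 by simp
  qed
qed

end

subsection \<open>Gradient and Hessian in terms of directional derivatives\<close>

lemma gradient_inner:
  assumes "f differentiable (at x)"
  shows "gradient f x \<bullet> v = dird v f x"
proof -
  have "gradient f x \<bullet> v = (\<Sum>i\<in>UNIV. v $ i * dird (axis i 1) f x)"
    by (simp add: gradient_def dird_def inner_vec_def mult.commute)
  then show ?thesis using dird_expand[OF assms, of v] by simp
qed

context
  fixes \<Omega> :: "(real ^ 'N) set"
  assumes op: "open \<Omega>"
begin

lemma dird_dird_expand:
  assumes f: "cont_diff_on 2 \<Omega> f" and x: "x \<in> \<Omega>"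
  shows "dird v (dird w f) x = (\<Sum>i\<in>UNIV. w $ i * dird v (dird (axis i 1) f) x)"
proof -
  have d: "f differentiable (at y)" "dird u f differentiable (at y)" if "y \<in> \<Omega>" for y u
    using f that by (auto simp: numeral_2_eq_2 cont_diff_on_Suc)
  have "dird v (dird w f) x = dird v (\<lambda>y. \<Sum>i\<in>UNIV. w $ i * dird (axis i 1) f y) x"
    by (rule dird_cong[OF op x]) (rule dird_expand[OF d(1)])
  also have "\<dots> = (\<Sum>i\<in>UNIV. w $ i * dird v (dird (axis i 1) f) x)"
    using d x by (subst dird_sum) (auto simp: dird_cmult)
  finally show ?thesis .
qed

text \<open>Row i of the Hessian is the derivative of the i-th partial derivative, so v becomes the
  outer and w the inner direction.\<close>

lemma hessian_inner:
  assumes f: "cont_diff_on 2 \<Omega> f" and x: "x \<in> \<Omega>"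
  shows "(hessian f x *v v) \<bullet> w = dird v (dird w f) x"
proof -
  have d: "dird u f differentiable (at x)" for u
    using f x by (auto simp: numeral_2_eq_2 cont_diff_on_Suc)
  have "(gradient f has_derivative (\<lambda>h. \<chi> i. dird h (dird (axis i 1) f) x)) (at x)"
    unfolding gradient_def[abs_def] dird_def[symmetric]
    by (subst has_derivative_componentwise_within)
      (auto simp: Basis_vec_def inner_axis intro!: has_derivative_dird[OF d])
  then have "(gradient f has_derivative (\<lambda>h. hessian f x *v h)) (at x)"
    using jacobian_works[of "gradient f" "at x"] by (auto simp: hessian_def differentiable_def)
  then have "(\<lambda>h. hessian f x *v h) = (\<lambda>h. \<chi> i. dird h (dird (axis i 1) f) x)"
    using has_derivative_unique \<open>(gradient f has_derivative (\<lambda>h. \<chi> i. dird h (dird (axis i 1) f) x)) (at x)\<close>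
    by blast
  then have "hessian f x *v v = (\<chi> i. dird v (dird (axis i 1) f) x)" by meson
  then show ?thesis
    by (subst dird_dird_expand[OF f x]) (simp add: inner_vec_def mult.commute)
qed

lemma first_order_part_eq:
  "f \<in> Ck k \<Omega> \<Longrightarrow> x \<in> \<Omega> \<Longrightarrow> first_order_part k b f x = (if 1 \<le> k then dird (b x) f x else 0)"
  using cont_diff_on_differentiable[OF op, of k f x]
  by (auto simp: first_order_part_def Ck_def gradient_inner)

lemma second_order_part_eq:
  "f \<in> Ck k \<Omega> \<Longrightarrow> x \<in> \<Omega> \<Longrightarrow>
   second_order_part k c f x = (if 2 \<le> k then dird (c x) (dird (c x) f) x else 0)"
  using cont_diff_on_mono[OF op, of k f 2]
  by (auto simp: second_order_part_def Ck_def hessian_inner)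

lemma leibniz_imp_power_identity:
  assumes T: "second_leibniz \<Omega> k T A" and A: "leibniz \<Omega> k A" and n: "n \<ge> 2"
  shows "power_identity n k \<Omega> T A"
  unfolding power_identity_def
proof (intro ballI)
  fix f x assume f: "f \<in> Ck k \<Omega>" and x: "x \<in> \<Omega>"
  note pow = Ck_power[OF op f]
  have A_Suc: "A (\<lambda>y. f y ^ Suc m) x = f x * A (\<lambda>y. f y ^ m) x + f x ^ m * A f x" for m
    using leibnizD[OF op A f pow x] by simp
  have A1: "A (\<lambda>_. 1) x = 0"
    using leibnizD[OF op A Ck_const[OF op] Ck_const[OF op] x, of 1 1] by simp
  \<comment> \<open>The factor \<open>f x\<close> on the left avoids the exponent m - 1, which would
    be truncated at m = 0.\<close>
  have A_pow: "f x * A (\<lambda>y. f y ^ m) x = real m * f x ^ m * A f x" for m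
    by (induction m) (simp_all only: A_Suc, simp_all add: A1 algebra_simps)
  have "T (\<lambda>y. f y ^ Suc m) x = real (Suc m) * f x ^ m * T f x + real (Suc m) * A f x * A (\<lambda>y. f y ^ m) x" for m
  proof (induction m)
    case 0
    then show ?case by (simp add: A1)
  next
    case (Suc m)
    have "T (\<lambda>y. f y ^ Suc (Suc m)) x = f x * T (\<lambda>y. f y ^ Suc m) x + f x ^ Suc m * T f x + 2 * A f x * A (\<lambda>y. f y ^ Suc m) x"
      using second_leibnizD[OF op T f pow[of "Suc m"] x] by (simp only: power_Suc)
    \<comment> \<open>Turns the cross term of the induction hypothesis, multiplied by f, into m A(f)
      A(f^(m+1)); with the 2 from the second-order rule this makes m + 2.\<close>
    moreover have "real (Suc m) * (f x * A (\<lambda>y. f y ^ m) x) = real m * A (\<lambda>y. f y ^ Suc m) x"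
      unfolding A_Suc A_pow by (simp add: algebra_simps)
    then have "real (Suc m) * A f x * (f x * A (\<lambda>y. f y ^ m) x) = real m * A f x * A (\<lambda>y. f y ^ Suc m) x"
      by (simp only: mult.assoc mult.left_commute[of _ "A f x"])
    ultimately show ?case
      unfolding Suc by (simp del: power_Suc add: algebra_simps) (simp add: algebra_simps)
  qed
  from this[of "n - 1"] n show "T (\<lambda>y. f y ^ n) x = real n * f x ^ (n - 1) * T f x + real n * A f x * A (\<lambda>y. f y ^ (n - 1)) x"
    by simp
qed

section \<open>The converse: operators given by the differential formula\<close>

context
  fixes k :: nat and b c :: "real ^ 'N \<Rightarrow> real ^ 'N" and T A
  assumes b: "continuous_on \<Omega> b" and c: "continuous_on \<Omega> c"
    and c0: "k = 1 \<Longrightarrow> x \<in> \<Omega> \<Longrightarrow> c x = 0"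
    and form: "has_differential_form k \<Omega> b c T A"
begin

lemma form_T: "f \<in> Ck k \<Omega> \<Longrightarrow> x \<in> \<Omega> \<Longrightarrow> T f x = (if 2 \<le> k then dird (c x) (dird (c x) f) x else 0)
    + (if 1 \<le> k then dird (b x) f x else 0)"
  using form by (simp add: has_differential_form_def first_order_part_eq second_order_part_eq)

lemma form_A: "f \<in> Ck k \<Omega> \<Longrightarrow> x \<in> \<Omega> \<Longrightarrow> A f x = (if 1 \<le> k then dird (c x) f x else 0)"
  using form by (simp add: has_differential_form_def first_order_part_eq)

lemma Ck_differentiable: "f \<in> Ck k \<Omega> \<Longrightarrow> 1 \<le> k \<Longrightarrow> x \<in> \<Omega> \<Longrightarrow> f differentiable (at x)"
  using cont_diff_on_differentiable[OF op] by (auto simp: Ck_def)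

lemma Ck_dird_differentiable:
  "f \<in> Ck k \<Omega> \<Longrightarrow> 2 \<le> k \<Longrightarrow> x \<in> \<Omega> \<Longrightarrow> dird v f differentiable (at x)"
  using cont_diff_on_mono[OF op, of k f 2] by (auto simp: Ck_def numeral_2_eq_2 cont_diff_on_Suc)

lemma form_leibniz: "leibniz \<Omega> k A"
  unfolding leibniz_def[OF op]
  by (auto simp: form_A Ck_mult[OF op] dird_mult Ck_differentiable)

lemma dird_dird_mult:
  assumes f: "f \<in> Ck k \<Omega>" and g: "g \<in> Ck k \<Omega>" and x: "x \<in> \<Omega>" and k: "2 \<le> k"
  shows "dird v (dird v (\<lambda>y. f y * g y)) x
    = f x * dird v (dird v g) x + g x * dird v (dird v f) x + 2 * dird v f x * dird v g x"
proof -
  have "dird v (dird v (\<lambda>y. f y * g y)) x = dird v (\<lambda>y. f y * dird v g y + dird v f y * g y) x"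
    using k by (intro dird_cong[OF op x] dird_mult Ck_differentiable f g) auto
  also have "\<dots> = f x * dird v (dird v g) x + g x * dird v (dird v f) x + 2 * dird v f x * dird v g x"
    using k x f g
    by (subst dird_add) (auto simp: dird_mult Ck_differentiable Ck_dird_differentiable)
  finally show ?thesis .
qed

text \<open>For k at least 2 the cross term comes from differentiating a product twice. For k = 1
  the second-order part is read as 0, so the cross term has to vanish by itself, which is the role
  of c = 0.\<close>

lemma form_second_leibniz: "second_leibniz \<Omega> k T A"
  unfolding second_leibniz_def[OF op]
proof (intro ballI)
  fix f g x assume f: "f \<in> Ck k \<Omega>" and g: "g \<in> Ck k \<Omega>" and x: "x \<in> \<Omega>"
  consider "k = 0" | "k = 1" | "2 \<le> k" by linarith
  then show "T (\<lambda>y. f y * g y) x = f x * T g x + g x * T f x + 2 * A f x * A g x"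
  proof cases
    case 1
    then show ?thesis using f g x by (simp add: form_T form_A Ck_mult[OF op])
  next
    case 2
    then show ?thesis
      using f g x c0[OF 2 x] by (simp add: form_T form_A Ck_mult[OF op] dird_mult Ck_differentiable)
  next
    case 3
    then show ?thesis
      using f g x by (simp add: form_T form_A Ck_mult[OF op] dird_dird_mult dird_mult Ck_differentiable algebra_simps)
  qed
qed

lemma form_additive: "additive_operator k \<Omega> T" "additive_operator k \<Omega> A"
proof -
  have "dird v (dird v (\<lambda>y. f y + g y)) x = dird v (dird v f) x + dird v (dird v g) x"
    if f: "f \<in> Ck k \<Omega>" and g: "g \<in> Ck k \<Omega>" and x: "x \<in> \<Omega>" and k: "2 \<le> k" for f g x v
  proof -
    have "dird v (dird v (\<lambda>y. f y + g y)) x = dird v (\<lambda>y. dird v f y + dird v g y) x"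
      using k by (intro dird_cong[OF op x] dird_add Ck_differentiable f g) auto
    then show ?thesis using that by (simp add: dird_add Ck_dird_differentiable)
  qed
  then show "additive_operator k \<Omega> T" "additive_operator k \<Omega> A"
    unfolding additive_operator_def
    by (auto simp: form_T form_A Ck_add[OF op] dird_add Ck_differentiable)
qed

text \<open>The direction varies with the point, whereas \<open>Ck\<close> controls fixed
  directions; expanding in coordinate directions separates the two.\<close>

lemma continuous_first_order:
  assumes f: "f \<in> Ck k \<Omega>" and k: "1 \<le> k" and w: "continuous_on \<Omega> w"
  shows "continuous_on \<Omega> (\<lambda>x. dird (w x) f x)"
proof -
  obtain m where m: "k = Suc m" using k by (cases k) auto
  have "cont_diff_on m \<Omega> (dird v f)" for v
    using f by (simp add: m Ck_def cont_diff_on_Suc)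
  then have "continuous_on \<Omega> (dird v f)" for v
    by (rule cont_diff_on_continuous[OF op])
  then have "continuous_on \<Omega> (\<lambda>x. \<Sum>i\<in>UNIV. w x $ i * dird (axis i 1) f x)"
    by (intro continuous_intros w)
  then show ?thesis
    by (rule continuous_on_eq) (simp add: dird_expand[OF Ck_differentiable[OF f k], symmetric])
qed

text \<open>The moving direction occupies both slots, so the expansion is made twice; the inner
  vector is constant under the outer derivative.\<close>

lemma continuous_second_order:
  assumes f: "f \<in> Ck k \<Omega>" and k: "2 \<le> k"
  shows "continuous_on \<Omega> (\<lambda>x. dird (c x) (dird (c x) f) x)"
proof -
  have f2: "cont_diff_on 2 \<Omega> f" using f k cont_diff_on_mono[OF op] by (auto simp: Ck_def)
  have "continuous_on \<Omega> (\<lambda>x. dird (c x) (dird (axis i 1) f) x)" for i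
  proof -
    have D: "cont_diff_on 1 \<Omega> (dird (axis i 1) f)"
      using f2 by (simp add: numeral_2_eq_2 cont_diff_on_Suc)
    then have "continuous_on \<Omega> (dird v (dird (axis i 1) f))" for v
      by (simp add: cont_diff_on_Suc)
    then have "continuous_on \<Omega> (\<lambda>x. \<Sum>j\<in>UNIV. c x $ j * dird (axis j 1) (dird (axis i 1) f) x)"
      by (intro continuous_intros c)
    moreover have "dird (axis i 1) f differentiable (at x)" if "x \<in> \<Omega>" for x
      using D that by (simp add: cont_diff_on_Suc)
    ultimately show ?thesis
      by (elim continuous_on_eq) (simp add: dird_expand[symmetric])
  qed
  then have "continuous_on \<Omega> (\<lambda>x. \<Sum>i\<in>UNIV. c x $ i * dird (c x) (dird (axis i 1) f) x)"
    by (intro continuous_intros c)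
  then show ?thesis
    by (rule continuous_on_eq) (simp add: dird_dird_expand[OF f2, symmetric])
qed

lemma form_Ck_operator: "Ck_operator k \<Omega> T" "Ck_operator k \<Omega> A"
proof -
  have "continuous_on \<Omega> (\<lambda>x. (if 2 \<le> k then dird (c x) (dird (c x) f) x else 0)
    + (if 1 \<le> k then dird (b x) f x else 0))" if "f \<in> Ck k \<Omega>" for f
    using continuous_first_order[OF that _ b] continuous_second_order[OF that]
    by (cases "1 \<le> k"; cases "2 \<le> k") (auto intro: continuous_on_add)
  then have "continuous_on \<Omega> (T f)" if "f \<in> Ck k \<Omega>" for f
    by (rule continuous_on_eq[OF _ form_T[OF that, symmetric]]) (use that in auto)
  moreover have "continuous_on \<Omega> (\<lambda>x. if 1 \<le> k then dird (c x) f x else 0)" if "f \<in> Ck k \<Omega>" for f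
    using continuous_first_order[OF that _ c] by (cases "1 \<le> k") auto
  then have "continuous_on \<Omega> (A f)" if "f \<in> Ck k \<Omega>" for f
    by (rule continuous_on_eq[OF _ form_A[OF that, symmetric]]) (use that in auto)
  moreover have "T f x = T g x \<and> A f x = A g x"
    if f: "f \<in> Ck k \<Omega>" and g: "g \<in> Ck k \<Omega>" and eq: "\<And>x. x \<in> \<Omega> \<Longrightarrow> f x = g x" and x: "x \<in> \<Omega>" for f g x
  proof -
    have 1: "dird v f y = dird v g y" if "y \<in> \<Omega>" for v y
      by (rule dird_cong[OF op that eq])
    have "dird v (dird v f) x = dird v (dird v g) x" for v
      by (rule dird_cong[OF op x 1])
    with 1[OF x] show ?thesis using f g x by (simp add: form_T form_A)
  qed
  ultimately show "Ck_operator k \<Omega> T" "Ck_operator k \<Omega> A"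
    unfolding Ck_operator_def by blast+
qed

end

end

theorem theorem3:
  fixes \<Omega> :: "(real ^ 'N) set" and n k :: nat
  assumes "domain_set \<Omega>" and "n \<ge> 2"
  shows "(\<forall>T A.
            Ck_operator k \<Omega> T \<and> Ck_operator k \<Omega> A \<and>
            additive_operator k \<Omega> T \<and> additive_operator k \<Omega> A \<and>
            power_identity n k \<Omega> T A \<and>
            non_degenerate k \<Omega> A \<and>
            depends_nontrivially_on_derivative k \<Omega> A \<and>
            (\<forall>x\<in>\<Omega>. A (\<lambda>_. 1) x = 0) \<and>
            (n = 2 \<or> (\<forall>x\<in>\<Omega>. A (\<lambda>_. 1) x = 0))
            \<longrightarrow>
            (\<exists>b c. continuous_on \<Omega> b \<and> continuous_on \<Omega> c \<and>
               has_differential_form k \<Omega> b c T A \<and>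
               (k = 1 \<longrightarrow> (\<forall>x\<in>\<Omega>. c x = 0)) \<and>
               (k = 0 \<longrightarrow> (\<forall>x\<in>\<Omega>. b x = 0 \<and> c x = 0))))
         \<and>
         (\<forall>b c T A.
            continuous_on \<Omega> b \<and> continuous_on \<Omega> c \<and>
            (k = 1 \<longrightarrow> (\<forall>x\<in>\<Omega>. c x = 0)) \<and>
            (k = 0 \<longrightarrow> (\<forall>x\<in>\<Omega>. b x = 0 \<and> c x = 0)) \<and>
            has_differential_form k \<Omega> b c T A
            \<longrightarrow>
            Ck_operator k \<Omega> T \<and> Ck_operator k \<Omega> A \<and>
            additive_operator k \<Omega> T \<and> additive_operator k \<Omega> A \<and>
            power_identity n k \<Omega> T A)"
proof (intro conjI allI impI; (elim conjE)?)
  have op: "open \<Omega>" using assms(1) by (simp add: domain_set_def)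
  fix T A
  assume T: "Ck_operator k \<Omega> T" "additive_operator k \<Omega> T"
    and A: "Ck_operator k \<Omega> A" "additive_operator k \<Omega> A"
    and pow: "power_identity n k \<Omega> T A" and nd: "non_degenerate k \<Omega> A"
    and A1: "\<forall>x\<in>\<Omega>. A (\<lambda>_. 1) x = 0"
  have TL: "second_leibniz \<Omega> k T A"
    using power_identity_imp_second_leibniz[OF op T A pow assms(2)] A1 by blast
  have AL: "leibniz \<Omega> k A"
    using second_leibniz_imp_leibniz[OF op TL A nd] A1 by blast
  note ctx = op T A TL AL
  show "\<exists>b c. continuous_on \<Omega> b \<and> continuous_on \<Omega> c \<and>
      has_differential_form k \<Omega> b c T A \<and>
      (k = 1 \<longrightarrow> (\<forall>x\<in>\<Omega>. c x = 0)) \<and> (k = 0 \<longrightarrow> (\<forall>x\<in>\<Omega>. b x = 0 \<and> c x = 0))"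
  proof (intro exI conjI)
    \<comment> \<open>The only candidates: coordinate functions have constant gradient and zero
      Hessian, so b and c must be the values of \<open>T\<close> and \<open>A\<close> on
      them.\<close>
    show "continuous_on \<Omega> (T_coeff T)" "continuous_on \<Omega> (A_coeff A)"
      using continuous_coeffs[OF ctx] by auto
    show "has_differential_form k \<Omega> (T_coeff T) (A_coeff A) T A"
      unfolding has_differential_form_def
      using T_eq_dird[OF ctx] A_eq_dird[OF ctx]
      by (simp add: first_order_part_eq[OF op] second_order_part_eq[OF op])
    show "k = 1 \<longrightarrow> (\<forall>x\<in>\<Omega>. A_coeff A x = 0)"
      using A_coeff_eq_0[OF ctx] by simp
    show "k = 0 \<longrightarrow> (\<forall>x\<in>\<Omega>. T_coeff T x = 0 \<and> A_coeff A x = 0)"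
      using A_coeff_eq_0[OF ctx] T_coeff_eq_0[OF ctx] by simp
  qed
next
  have op: "open \<Omega>" using assms(1) by (simp add: domain_set_def)
  fix b c T A
  assume b: "continuous_on \<Omega> b" and c: "continuous_on \<Omega> c"
    and c0: "k = 1 \<longrightarrow> (\<forall>x\<in>\<Omega>. c x = 0)" and form: "has_differential_form k \<Omega> b c T A"
  have c0': "c x = 0" if "k = 1" "x \<in> \<Omega>" for x using c0 that by blast
  show "Ck_operator k \<Omega> T" "Ck_operator k \<Omega> A" "additive_operator k \<Omega> T" "additive_operator k \<Omega> A"
    using form_Ck_operator[OF op b c c0' form] form_additive[OF op b c c0' form] by auto
  show "power_identity n k \<Omega> T A"
    by (rule leibniz_imp_power_identity[OF op form_second_leibniz[OF op b c c0' form]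
          form_leibniz[OF op b c c0' form] assms(2)])
qed

end
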